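(* Let $G$ and $H$ be (discrete) groups which are both $\omega$-saturated as structures in the language of pure groups, and suppose $G\preceq H$ in the language of pure groups. Then $(\ell^{1}(G),* )\preceq(\ell^{1}(H),* )$ as $\mathcal{L}_{\mathrm{cnv}}$-structures.
   Context: For a discrete group $G$, $(\ell^1(G),* )$ denotes the convolution algebra of $G$: the real Banach lattice $\ell^1(G)$ (functions $f:G\to\mathbb{R}$ with $\|f\|=\sum_{x}|f(x)|<\infty$, pointwise order) equipped with convolution $(f*g)(x)=\sum_{y\in G}f(y)g(y^{-1}x)$. It is regarded as a metric structure in continuous first-order logic in the language $\mathcal{L}_{\mathrm{cnv}}=\{+,0,\wedge,\vee,\|\cdot\|,*\}$ with metric $d(f,g)=\|f-g\|$; formally one works in the unit ball, treating $+,\wedge,\vee$ as maps from the unit ball to the ball of radius $2$ (or rescaling them by $1/2$). When $G\le H$, $\ell^1(G)$ is viewed as a substructure of $\ell^1(H)$ via extension by zero. $\preceq$ between convolution algebras is elementary substructure in continuous logic. The language of pure groups is $\mathcal{L}_{\mathrm{grp}}=\{\cdot\}$; elementary substructure and $\omega$-saturation of groups (every complete type over a finite parameter set is realized) are in the sense of classical first-order logic. *)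

theory Defs
  imports "HOL-Analysis.Analysis" "HOL-Algebra.Group"
begin

text \<open>The type parameter is the type of parameters (extra constant symbols, interpreted by
  themselves). Formulas of the pure language are those with an empty parameter set.\<close>

datatype (grp_term_params: 'c) grp_term =
    GVar nat
  | GParam 'c
  | GMult "'c grp_term" "'c grp_term"

datatype (grp_params: 'c) grp_form =
    GEq "'c grp_term" "'c grp_term"
  | GNeg "'c grp_form"
  | GConj "'c grp_form" "'c grp_form"
  | GEx nat "'c grp_form"

primrec grp_term_vars :: "'c grp_term \<Rightarrow> nat set" where
  "grp_term_vars (GVar i) = {i}"
| "grp_term_vars (GParam c) = {}"
| "grp_term_vars (GMult s t) = grp_term_vars s \<union> grp_term_vars t"

primrec grp_free_vars :: "'c grp_form \<Rightarrow> nat set" where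
  "grp_free_vars (GEq s t) = grp_term_vars s \<union> grp_term_vars t"
| "grp_free_vars (GNeg \<phi>) = grp_free_vars \<phi>"
| "grp_free_vars (GConj \<phi> \<psi>) = grp_free_vars \<phi> \<union> grp_free_vars \<psi>"
| "grp_free_vars (GEx i \<phi>) = grp_free_vars \<phi> - {i}"

primrec grp_term_val :: "('a, 'm) monoid_scheme \<Rightarrow> 'a grp_term \<Rightarrow> (nat \<Rightarrow> 'a) \<Rightarrow> 'a" where
  "grp_term_val G (GVar i) v = v i"
| "grp_term_val G (GParam c) v = c"
| "grp_term_val G (GMult s t) v = grp_term_val G s v \<otimes>\<^bsub>G\<^esub> grp_term_val G t v"

primrec grp_sat :: "('a, 'm) monoid_scheme \<Rightarrow> 'a grp_form \<Rightarrow> (nat \<Rightarrow> 'a) \<Rightarrow> bool" where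
  "grp_sat G (GEq s t) v \<longleftrightarrow> grp_term_val G s v = grp_term_val G t v"
| "grp_sat G (GNeg \<phi>) v \<longleftrightarrow> \<not> grp_sat G \<phi> v"
| "grp_sat G (GConj \<phi> \<psi>) v \<longleftrightarrow> grp_sat G \<phi> v \<and> grp_sat G \<psi> v"
| "grp_sat G (GEx i \<phi>) v \<longleftrightarrow> (\<exists>a\<in>carrier G. grp_sat G \<phi> (v(i := a)))"

definition grp_elementary_substructure ::
    "('a, 'm) monoid_scheme \<Rightarrow> ('a, 'n) monoid_scheme \<Rightarrow> bool" where
  "grp_elementary_substructure G H \<longleftrightarrow>
     carrier G \<subseteq> carrier H \<and>
     (\<forall>x\<in>carrier G. \<forall>y\<in>carrier G. x \<otimes>\<^bsub>G\<^esub> y = x \<otimes>\<^bsub>H\<^esub> y) \<and>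
     (\<forall>\<phi> v. grp_params \<phi> = {} \<longrightarrow> range v \<subseteq> carrier G \<longrightarrow> (grp_sat G \<phi> v \<longleftrightarrow> grp_sat H \<phi> v))"

definition grp_formulas_over :: "'a set \<Rightarrow> nat \<Rightarrow> 'a grp_form set" where
  "grp_formulas_over A n = {\<phi>. grp_params \<phi> \<subseteq> A \<and> grp_free_vars \<phi> \<subseteq> {..<n}}"

text \<open>Complete \<open>n\<close>-types over \<open>A\<close>, in the variables \<open>0, \<dots>, n - 1\<close>; consistency with the
  theory of \<open>G\<close> over \<open>A\<close> is finite satisfiability in \<open>G\<close>.\<close>

definition grp_complete_type ::
    "('a, 'm) monoid_scheme \<Rightarrow> 'a set \<Rightarrow> nat \<Rightarrow> 'a grp_form set \<Rightarrow> bool" where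
  "grp_complete_type G A n p \<longleftrightarrow>
     p \<subseteq> grp_formulas_over A n \<and>
     (\<forall>F. F \<subseteq> p \<longrightarrow> finite F \<longrightarrow> (\<exists>v. range v \<subseteq> carrier G \<and> (\<forall>\<phi>\<in>F. grp_sat G \<phi> v))) \<and>
     (\<forall>\<phi>\<in>grp_formulas_over A n. \<phi> \<in> p \<or> GNeg \<phi> \<in> p)"

definition grp_omega_saturated :: "('a, 'm) monoid_scheme \<Rightarrow> bool" where
  "grp_omega_saturated G \<longleftrightarrow>
     (\<forall>A n p. A \<subseteq> carrier G \<longrightarrow> finite A \<longrightarrow> grp_complete_type G A n p \<longrightarrow>
        (\<exists>v. range v \<subseteq> carrier G \<and> (\<forall>\<phi>\<in>p. grp_sat G \<phi> v)))"

record 'm cnv_structure =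
  cnv_univ :: "'m set"
  cnv_zero :: 'm
  cnv_plus :: "'m \<Rightarrow> 'm \<Rightarrow> 'm"
  cnv_meet :: "'m \<Rightarrow> 'm \<Rightarrow> 'm"
  cnv_join :: "'m \<Rightarrow> 'm \<Rightarrow> 'm"
  cnv_star :: "'m \<Rightarrow> 'm \<Rightarrow> 'm"
  cnv_norm :: "'m \<Rightarrow> real"
  cnv_dist :: "'m \<Rightarrow> 'm \<Rightarrow> real"

datatype cnv_term =
    CVar nat
  | CZero
  | CPlus cnv_term cnv_term
  | CMeet cnv_term cnv_term
  | CJoin cnv_term cnv_term
  | CStar cnv_term cnv_term

text \<open>An \<open>n\<close>-ary connective is a continuous map from real \<open>n\<close>-space to the reals. It is encoded
  as a map on real sequences, continuous for the product topology and applied to the \<open>n\<close>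
  values of the subformulas padded with zeros; composing with the projection to,
  respectively the padding from, real \<open>n\<close>-space shows that exactly the continuous
  \<open>n\<close>-ary connectives arise.\<close>

datatype cnv_form =
    CDist cnv_term cnv_term
  | CNorm cnv_term
  | CConn "(nat \<Rightarrow> real) \<Rightarrow> real" "cnv_form list"
  | CSup nat cnv_form
  | CInf nat cnv_form

fun cnv_wf :: "cnv_form \<Rightarrow> bool" where
  "cnv_wf (CDist s t) \<longleftrightarrow> True"
| "cnv_wf (CNorm t) \<longleftrightarrow> True"
| "cnv_wf (CConn u \<phi>s) \<longleftrightarrow> continuous_on UNIV u \<and> (\<forall>\<phi>\<in>set \<phi>s. cnv_wf \<phi>)"
| "cnv_wf (CSup i \<phi>) \<longleftrightarrow> cnv_wf \<phi>"
| "cnv_wf (CInf i \<phi>) \<longleftrightarrow> cnv_wf \<phi>"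

primrec cnv_term_val :: "'m cnv_structure \<Rightarrow> cnv_term \<Rightarrow> (nat \<Rightarrow> 'm) \<Rightarrow> 'm" where
  "cnv_term_val M (CVar i) v = v i"
| "cnv_term_val M CZero v = cnv_zero M"
| "cnv_term_val M (CPlus s t) v = cnv_plus M (cnv_term_val M s v) (cnv_term_val M t v)"
| "cnv_term_val M (CMeet s t) v = cnv_meet M (cnv_term_val M s v) (cnv_term_val M t v)"
| "cnv_term_val M (CJoin s t) v = cnv_join M (cnv_term_val M s v) (cnv_term_val M t v)"
| "cnv_term_val M (CStar s t) v = cnv_star M (cnv_term_val M s v) (cnv_term_val M t v)"

fun cnv_val :: "'m cnv_structure \<Rightarrow> cnv_form \<Rightarrow> (nat \<Rightarrow> 'm) \<Rightarrow> real" where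
  "cnv_val M (CDist s t) v = cnv_dist M (cnv_term_val M s v) (cnv_term_val M t v)"
| "cnv_val M (CNorm t) v = cnv_norm M (cnv_term_val M t v)"
| "cnv_val M (CConn u \<phi>s) v =
     u (\<lambda>i. if i < length \<phi>s then map (\<lambda>\<phi>. cnv_val M \<phi> v) \<phi>s ! i else 0)"
| "cnv_val M (CSup i \<phi>) v = (SUP a\<in>cnv_univ M. cnv_val M \<phi> (v(i := a)))"
| "cnv_val M (CInf i \<phi>) v = (INF a\<in>cnv_univ M. cnv_val M \<phi> (v(i := a)))"

definition cnv_substructure :: "'m cnv_structure \<Rightarrow> 'm cnv_structure \<Rightarrow> bool" where
  "cnv_substructure M N \<longleftrightarrow>
     cnv_univ M \<subseteq> cnv_univ N \<and>
     cnv_zero M = cnv_zero N \<and>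
     (\<forall>f\<in>cnv_univ M. cnv_norm M f = cnv_norm N f) \<and>
     (\<forall>f\<in>cnv_univ M. \<forall>g\<in>cnv_univ M.
        cnv_plus M f g = cnv_plus N f g \<and>
        cnv_meet M f g = cnv_meet N f g \<and>
        cnv_join M f g = cnv_join N f g \<and>
        cnv_star M f g = cnv_star N f g \<and>
        cnv_dist M f g = cnv_dist N f g)"

definition cnv_elementary_substructure :: "'m cnv_structure \<Rightarrow> 'm cnv_structure \<Rightarrow> bool" where
  "cnv_elementary_substructure M N \<longleftrightarrow>
     cnv_substructure M N \<and>
     (\<forall>\<phi> v. cnv_wf \<phi> \<longrightarrow> range v \<subseteq> cnv_univ M \<longrightarrow> cnv_val M \<phi> v = cnv_val N \<phi> v)"

text \<open>Functions on the group are represented by functions on the whole type that vanish off the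
  carrier, so that extension by zero to a larger group is the identity map.\<close>

definition ell1 :: "('a, 'm) monoid_scheme \<Rightarrow> ('a \<Rightarrow> real) set" where
  "ell1 G = {f. (\<forall>x. x \<notin> carrier G \<longrightarrow> f x = 0) \<and> (\<lambda>x. \<bar>f x\<bar>) summable_on carrier G}"

definition ell1_norm :: "('a, 'm) monoid_scheme \<Rightarrow> ('a \<Rightarrow> real) \<Rightarrow> real" where
  "ell1_norm G f = (\<Sum>\<^sub>\<infinity>x\<in>carrier G. \<bar>f x\<bar>)"

definition convolution ::
    "('a, 'm) monoid_scheme \<Rightarrow> ('a \<Rightarrow> real) \<Rightarrow> ('a \<Rightarrow> real) \<Rightarrow> 'a \<Rightarrow> real" where
  "convolution G f g x =
     (if x \<in> carrier G then \<Sum>\<^sub>\<infinity>y\<in>carrier G. f y * g (inv\<^bsub>G\<^esub> y \<otimes>\<^bsub>G\<^esub> x) else 0)"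

text \<open>The one-sorted metric structure on the unit ball: \<open>+\<close>, \<open>\<and>\<close>, \<open>\<or>\<close> map pairs from the unit
  ball to the ball of radius 2 and are rescaled by 1/2.\<close>

definition conv_algebra :: "('a, 'm) monoid_scheme \<Rightarrow> ('a \<Rightarrow> real) cnv_structure" where
  "conv_algebra G = \<lparr>
     cnv_univ = {f \<in> ell1 G. ell1_norm G f \<le> 1},
     cnv_zero = (\<lambda>x. 0),
     cnv_plus = (\<lambda>f g x. (f x + g x) / 2),
     cnv_meet = (\<lambda>f g x. min (f x) (g x) / 2),
     cnv_join = (\<lambda>f g x. max (f x) (g x) / 2),
     cnv_star = convolution G,
     cnv_norm = ell1_norm G,
     cnv_dist = (\<lambda>f g. ell1_norm G (\<lambda>x. f x - g x))\<rparr>"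

end

theory Submission
  imports Defs
begin

text \<open>Finite tuples of \<open>G\<close> and \<open>H\<close> with the same type form a back-and-forth system, by saturation
  of both groups. Two such tuples \<open>a\<close>, \<open>b\<close> induce an isomorphism between the subsemigroups they
  generate, and functions that correspond under this isomorphism have equal norms, distances and
  term values. By induction, every formula takes the same value at corresponding tuples of
  functions: at a quantifier, the witness is first approximated by a finitely supported function,
  whose support can be added to the tuples, and the error is controlled because formulas are
  uniformly continuous on the unit ball. The same approximation reduces elementarity for arbitrary
  parameters of \<open>\<ell>\<^sup>1(G)\<close> to finitely supported ones, where \<open>G \<preceq> H\<close> provides the initial pair of
  tuples.\<close>

section \<open>Finite tuples with the same type\<close>

text \<open>The relation between G and H speaks of single first-order formulas, whereas
  \<open>CSup\<close> ranges over functions with finite supports of unbounded size, so its value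
  depends on which types over a tuple are realised. Saturation of both groups makes tuples of the
  same type realise the same further types. A witness found in H may lie outside G, which is why two
  different tuples have to be compared, even though the parameters start out equal.

  Subsemigroups occur instead of subgroups because terms of the group language form only products.
  They suffice: if two functions vanish off a subsemigroup S, their convolution at x sums over the
  factorisations x = y z with both factors in S, so inverses never have to correspond.

  Witnesses match only approximately, but the induction hypothesis is exact equality of values. Each
  quantifier therefore has its own error, which tends to 0 before the next quantifier is treated,
  and errors do not accumulate through nested quantifiers.\<close>

lemma grp_term_val_cong:
  "(\<And>i. i \<in> grp_term_vars t \<Longrightarrow> v i = w i) \<Longrightarrow> grp_term_val G t v = grp_term_val G t w"
  by (induction t) auto

lemma grp_sat_cong:
  "(\<And>i. i \<in> grp_free_vars \<phi> \<Longrightarrow> v i = w i) \<Longrightarrow> grp_sat G \<phi> v \<longleftrightarrow> grp_sat G \<phi> w"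
proof (induction \<phi> arbitrary: v w)
  case (GEq s t)
  have "grp_term_val G s v = grp_term_val G s w" "grp_term_val G t v = grp_term_val G t w"
    by (rule grp_term_val_cong; simp add: GEq.prems)+
  then show ?case by simp
next
  case (GNeg \<phi>)
  have "grp_sat G \<phi> v \<longleftrightarrow> grp_sat G \<phi> w"
    by (rule GNeg.IH) (simp add: GNeg.prems)
  then show ?case by simp
next
  case (GConj \<phi> \<psi>)
  have "grp_sat G \<phi> v \<longleftrightarrow> grp_sat G \<phi> w" "grp_sat G \<psi> v \<longleftrightarrow> grp_sat G \<psi> w"
    by (rule GConj.IH; simp add: GConj.prems)+
  then show ?case by simp
next
  case (GEx i \<phi>)
  have "grp_sat G \<phi> (v(i := a)) \<longleftrightarrow> grp_sat G \<phi> (w(i := a))" for a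
    by (rule GEx.IH) (simp add: GEx.prems)
  then show ?case by simp
qed

definition finitely_satisfiable :: "('a, 'm) monoid_scheme \<Rightarrow> 'a grp_form set \<Rightarrow> bool" where
  "finitely_satisfiable G p \<longleftrightarrow>
     (\<forall>F. F \<subseteq> p \<longrightarrow> finite F \<longrightarrow> (\<exists>v. range v \<subseteq> carrier G \<and> (\<forall>\<phi>\<in>F. grp_sat G \<phi> v)))"

text \<open>If both extensions failed, the two finite counterexamples without \<phi> and
  \<open>GNeg \<phi>\<close> would together form a finite subset of \<open>p\<close>. A valuation
  satisfying it decides \<phi>, and thereby satisfies one of the counterexamples.\<close>

lemma finitely_satisfiable_insert:
  assumes p: "finitely_satisfiable G p"
  shows "finitely_satisfiable G (insert \<phi> p) \<or> finitely_satisfiable G (insert (GNeg \<phi>) p)"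
proof (rule ccontr)
  assume *: "\<not> ?thesis"
  from * obtain F1 where F1: "F1 \<subseteq> insert \<phi> p" "finite F1"
    and n1: "\<And>v. range v \<subseteq> carrier G \<Longrightarrow> \<exists>\<psi>\<in>F1. \<not> grp_sat G \<psi> v"
    unfolding finitely_satisfiable_def by meson
  from * obtain F2 where F2: "F2 \<subseteq> insert (GNeg \<phi>) p" "finite F2"
    and n2: "\<And>v. range v \<subseteq> carrier G \<Longrightarrow> \<exists>\<psi>\<in>F2. \<not> grp_sat G \<psi> v"
    unfolding finitely_satisfiable_def by meson
  have "(F1 - {\<phi>}) \<union> (F2 - {GNeg \<phi>}) \<subseteq> p" "finite ((F1 - {\<phi>}) \<union> (F2 - {GNeg \<phi>}))"
    using F1 F2 by auto
  then obtain v where v: "range v \<subseteq> carrier G"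
    "\<And>\<psi>. \<psi> \<in> (F1 - {\<phi>}) \<union> (F2 - {GNeg \<phi>}) \<Longrightarrow> grp_sat G \<psi> v"
    using p unfolding finitely_satisfiable_def by meson
  show False
  proof (cases "grp_sat G \<phi> v")
    case True
    moreover obtain \<psi> where "\<psi> \<in> F1" "\<not> grp_sat G \<psi> v" using n1[OF v(1)] by blast
    ultimately show False using v(2)[of \<psi>] by auto
  next
    case False
    moreover obtain \<psi> where "\<psi> \<in> F2" "\<not> grp_sat G \<psi> v" using n2[OF v(1)] by blast
    ultimately show False using v(2)[of \<psi>] by (cases "\<psi> = GNeg \<phi>") auto
  qed
qed

text \<open>Lindenbaum's lemma: a finite subset of the union of a chain lies in one member, so
  Zorn's lemma gives a maximal finitely satisfiable set, and
  \<open>finitely_satisfiable_insert\<close> makes it complete.\<close>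

lemma finitely_satisfiable_extends_to_complete_type:
  assumes q: "q \<subseteq> grp_formulas_over A n" "finitely_satisfiable G q"
  obtains p where "q \<subseteq> p" "grp_complete_type G A n p"
proof -
  define \<A> where "\<A> = {p. q \<subseteq> p \<and> p \<subseteq> grp_formulas_over A n \<and> finitely_satisfiable G p}"
  have "\<exists>p\<in>\<A>. \<forall>X\<in>\<A>. p \<subseteq> X \<longrightarrow> X = p"
  proof (rule subset_Zorn_nonempty)
    show "\<A> \<noteq> {}" using q by (auto simp: \<A>_def)
    fix \<C> assume \<C>: "\<C> \<noteq> {}" "subset.chain \<A> \<C>"
    then have sub: "\<C> \<subseteq> \<A>" by (simp add: subset_chain_def)
    have "finitely_satisfiable G (\<Union>\<C>)"
      unfolding finitely_satisfiable_def
    proof (intro allI impI)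
      fix F assume "F \<subseteq> \<Union>\<C>" "finite F"
      then obtain p where "p \<in> \<C>" "F \<subseteq> p"
        using finite_subset_Union_chain \<C> by blast
      then show "\<exists>v. range v \<subseteq> carrier G \<and> (\<forall>\<phi>\<in>F. grp_sat G \<phi> v)"
        using sub \<open>finite F\<close> by (auto simp: \<A>_def finitely_satisfiable_def)
    qed
    then show "\<Union>\<C> \<in> \<A>" using sub \<C>(1) by (auto simp: \<A>_def)
  qed
  then obtain p where p: "p \<in> \<A>" and max: "\<And>X. X \<in> \<A> \<Longrightarrow> p \<subseteq> X \<Longrightarrow> X = p" by blast
  have "\<phi> \<in> p \<or> GNeg \<phi> \<in> p" if "\<phi> \<in> grp_formulas_over A n" for \<phi>
  proof -
    have "insert \<phi> p \<in> \<A> \<or> insert (GNeg \<phi>) p \<in> \<A>"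
      using finitely_satisfiable_insert[of G p \<phi>] p that
      by (auto simp: \<A>_def grp_formulas_over_def)
    then show ?thesis using max by blast
  qed
  then show ?thesis
    using p that[of p] by (auto simp: \<A>_def grp_complete_type_def finitely_satisfiable_def)
qed

abbreviation grp_conj_list :: "'c grp_form list \<Rightarrow> 'c grp_form" where
  "grp_conj_list \<phi>s \<equiv> foldr GConj \<phi>s (GEq (GVar 0) (GVar 0))"

lemma grp_sat_conj_list: "grp_sat G (grp_conj_list \<phi>s) v \<longleftrightarrow> (\<forall>\<phi>\<in>set \<phi>s. grp_sat G \<phi> v)"
  by (induction \<phi>s) auto

text \<open>\<open>Suc n\<close> appears because the empty conjunction is the tautology equating
  variable 0 with itself, so variable 0 must be allowed.\<close>

lemma grp_conj_list_over:
  "set \<phi>s \<subseteq> grp_formulas_over A (Suc n) \<Longrightarrow> grp_conj_list \<phi>s \<in> grp_formulas_over A (Suc n)"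
  by (induction \<phi>s) (auto simp: grp_formulas_over_def)

definition same_type ::
    "('a, 'm) monoid_scheme \<Rightarrow> ('a, 'n) monoid_scheme \<Rightarrow> nat \<Rightarrow> (nat \<Rightarrow> 'a) \<Rightarrow> (nat \<Rightarrow> 'a) \<Rightarrow> bool" where
  "same_type G H k a b \<longleftrightarrow> range a \<subseteq> carrier G \<and> range b \<subseteq> carrier H \<and>
     (\<forall>\<phi>\<in>grp_formulas_over {} k. grp_sat G \<phi> a \<longleftrightarrow> grp_sat H \<phi> b)"

lemma same_type_sym: "same_type G H k a b \<Longrightarrow> same_type H G k b a"
  by (auto simp: same_type_def)

text \<open>The complete type to be realised has the entries of \<open>b\<close> as parameters, but only in
  the formulas \<open>x\<^sub>i = b\<^sub>i\<close>; this avoids substituting parameters into formulas.\<close>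

lemma same_type_extend_one:
  assumes st: "same_type G H k a b" and sat: "grp_omega_saturated H" and c: "c \<in> carrier G"
  obtains d where "d \<in> carrier H" "same_type G H (Suc k) (a(k := c)) (b(k := d))"
proof -
  let ?a = "a(k := c)"
  define q1 where "q1 = {\<phi> \<in> grp_formulas_over {} (Suc k). grp_sat G \<phi> ?a}"
  define q2 where "q2 = (\<lambda>i. GEq (GVar i) (GParam (b i))) ` {..<k}"
  have ra: "range ?a \<subseteq> carrier G" using st c by (auto simp: same_type_def)
  have rb: "range b \<subseteq> carrier H" using st by (auto simp: same_type_def)
  have "finitely_satisfiable H (q1 \<union> q2)"
    unfolding finitely_satisfiable_def
  proof (intro allI impI)
    fix F assume F: "F \<subseteq> q1 \<union> q2" "finite F"
    then obtain \<phi>s where \<phi>s: "set \<phi>s = F \<inter> q1"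
      using finite_list[of "F \<inter> q1"] by auto
    let ?\<psi> = "grp_conj_list \<phi>s"
    have \<psi>: "?\<psi> \<in> grp_formulas_over {} (Suc k)"
      by (rule grp_conj_list_over) (auto simp: \<phi>s q1_def)
    have "grp_sat G ?\<psi> ?a" by (auto simp: grp_sat_conj_list \<phi>s q1_def)
    \<comment> \<open>Quantifying the new coordinate away leaves a parameter-free formula in the
      first \<open>k\<close> variables, which the common type of \<open>a\<close> and
      \<open>b\<close> transfers to H.\<close>
    then have "grp_sat G (GEx k ?\<psi>) a" using c by auto
    moreover have "GEx k ?\<psi> \<in> grp_formulas_over {} k"
      using \<psi> by (auto simp: grp_formulas_over_def less_Suc_eq)
    ultimately have "grp_sat H (GEx k ?\<psi>) b" using st by (auto simp: same_type_def)
    then obtain d where d: "d \<in> carrier H" "grp_sat H ?\<psi> (b(k := d))" by auto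
    \<comment> \<open>Members of \<open>q2\<close> hold because the update at \<open>k\<close>
      leaves the entries of \<open>b\<close> below \<open>k\<close> unchanged.\<close>
    have "grp_sat H \<phi> (b(k := d))" if "\<phi> \<in> F" for \<phi>
      using that F d by (auto simp: grp_sat_conj_list \<phi>s q2_def)
    then show "\<exists>v. range v \<subseteq> carrier H \<and> (\<forall>\<phi>\<in>F. grp_sat H \<phi> v)"
      using d rb by (intro exI[of _ "b(k := d)"]) auto
  qed
  moreover have "q1 \<union> q2 \<subseteq> grp_formulas_over (b ` {..<k}) (Suc k)"
    by (auto simp: q1_def q2_def grp_formulas_over_def)
  ultimately obtain p where p: "q1 \<union> q2 \<subseteq> p"
      "grp_complete_type H (b ` {..<k}) (Suc k) p"
    using finitely_satisfiable_extends_to_complete_type by metis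
  moreover have "b ` {..<k} \<subseteq> carrier H" "finite (b ` {..<k})" using rb by auto
  ultimately obtain w where w: "range w \<subseteq> carrier H" "\<And>\<phi>. \<phi> \<in> p \<Longrightarrow> grp_sat H \<phi> w"
    using sat unfolding grp_omega_saturated_def by meson
  have wb: "w i = b i" if "i < k" for i
  proof -
    have "GEq (GVar i) (GParam (b i)) \<in> p" using p that by (auto simp: q2_def)
    then show ?thesis using w(2) by fastforce
  qed
  have wsat: "grp_sat H \<phi> w" if "\<phi> \<in> grp_formulas_over {} (Suc k)" "grp_sat G \<phi> ?a" for \<phi>
    using that p w(2) by (auto simp: q1_def)
  have "grp_sat G \<phi> ?a \<longleftrightarrow> grp_sat H \<phi> (b(k := w k))"
    if \<phi>: "\<phi> \<in> grp_formulas_over {} (Suc k)" for \<phi>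
  proof -
    \<comment> \<open>Realising \<open>q1\<close> gives only the direction from G to H; applied to
      the negation it gives the converse.\<close>
    have "GNeg \<phi> \<in> grp_formulas_over {} (Suc k)"
      using \<phi> by (auto simp: grp_formulas_over_def)
    then have "grp_sat G \<phi> ?a \<longleftrightarrow> grp_sat H \<phi> w"
      using wsat[OF \<phi>] wsat[of "GNeg \<phi>"] by auto
    also have "\<dots> \<longleftrightarrow> grp_sat H \<phi> (b(k := w k))"
      using \<phi> wb by (intro grp_sat_cong) (auto simp: grp_formulas_over_def less_Suc_eq)
    finally show ?thesis .
  qed
  moreover have "w k \<in> carrier H" using w(1) by auto
  ultimately show ?thesis
    using that[of "w k"] ra rb by (auto simp: same_type_def)
qed

lemma same_type_extend:
  assumes "same_type G H k a b" and "grp_omega_saturated H"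
    and "finite F" and "F \<subseteq> carrier G"
  obtains k' a' b' where "k \<le> k'" "same_type G H k' a' b'"
    "\<And>i. i < k \<Longrightarrow> a' i = a i" "\<And>i. i < k \<Longrightarrow> b' i = b i" "F \<subseteq> a' ` {..<k'}"
proof -
  have "\<exists>k' a' b'. k \<le> k' \<and> same_type G H k' a' b' \<and> (\<forall>i<k. a' i = a i) \<and>
          (\<forall>i<k. b' i = b i) \<and> F \<subseteq> a' ` {..<k'}"
    using assms(3,4)
  proof (induction F rule: finite_induct)
    case empty
    then show ?case using assms(1) by auto
  next
    case (insert c F)
    then obtain k' a' b' where IH: "k \<le> k'" "same_type G H k' a' b'" "\<forall>i<k. a' i = a i"
        "\<forall>i<k. b' i = b i" "F \<subseteq> a' ` {..<k'}"
      by auto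
    obtain d where "same_type G H (Suc k') (a'(k' := c)) (b'(k' := d))"
      using same_type_extend_one[OF IH(2) assms(2), of c] insert.prems by auto
    moreover have "insert c F \<subseteq> (a'(k' := c)) ` {..<Suc k'}"
      using IH(5) by (force simp: lessThan_Suc)
    ultimately show ?case
      using IH(1,3,4)
      by - (rule exI[of _ "Suc k'"], rule exI[of _ "a'(k' := c)"], rule exI[of _ "b'(k' := d)"],
          simp del: fun_upd_apply, simp)
  qed
  then show ?thesis using that by blast
qed

section \<open>Words and the subsemigroup generated by a tuple\<close>

definition grp_words :: "nat \<Rightarrow> 'c grp_term set" where
  "grp_words k = {t. grp_term_params t = {} \<and> grp_term_vars t \<subseteq> {..<k}}"

text \<open>This is the subsemigroup generated by the first \<open>k\<close> entries of
  \<open>a\<close>: terms have neither unit nor inverse. It is empty for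
  \<open>k = 0\<close>.\<close>

definition word_vals :: "('a, 'm) monoid_scheme \<Rightarrow> nat \<Rightarrow> (nat \<Rightarrow> 'a) \<Rightarrow> 'a set" where
  "word_vals G k a = (\<lambda>t. grp_term_val G t a) ` grp_words k"

text \<open>Equality of two words is an atomic formula, hence part of the type. One direction will
  make the induced map well defined, the other injective.\<close>

lemma same_type_word_eq_iff:
  assumes "same_type G H k a b" "s \<in> grp_words k" "t \<in> grp_words k"
  shows "grp_term_val G s a = grp_term_val G t a \<longleftrightarrow> grp_term_val H s b = grp_term_val H t b"
proof -
  have "GEq s t \<in> grp_formulas_over {} k"
    using assms(2,3) by (auto simp: grp_words_def grp_formulas_over_def)
  then show ?thesis using assms(1) by (fastforce simp: same_type_def)
qed

lemma grp_words_mono: "k \<le> k' \<Longrightarrow> grp_words k \<subseteq> grp_words k'"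
  by (auto simp: grp_words_def)

lemma word_val_cong:
  "t \<in> grp_words k \<Longrightarrow> (\<And>i. i < k \<Longrightarrow> a' i = a i) \<Longrightarrow> grp_term_val G t a' = grp_term_val G t a"
  by (auto simp: grp_words_def intro!: grp_term_val_cong)

section \<open>Transport along isomorphisms of subsemigroups\<close>

text \<open>Closure under products is asked of \<open>S\<close> alone; for \<open>S'\<close> it
  follows by transport along \<tau>.\<close>

locale subsemigroup_iso = G: group G + H: group H
  for G :: "('a, 'm) monoid_scheme" and H :: "('a, 'n) monoid_scheme" +
  fixes S S' :: "'a set" and \<tau> :: "'a \<Rightarrow> 'a"
  assumes S_sub: "S \<subseteq> carrier G" and S'_sub: "S' \<subseteq> carrier H"
    and bij: "bij_betw \<tau> S S'"
    and S_mult: "\<And>x y. x \<in> S \<Longrightarrow> y \<in> S \<Longrightarrow> x \<otimes>\<^bsub>G\<^esub> y \<in> S"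
    and \<tau>_mult: "\<And>x y. x \<in> S \<Longrightarrow> y \<in> S \<Longrightarrow> \<tau> (x \<otimes>\<^bsub>G\<^esub> y) = \<tau> x \<otimes>\<^bsub>H\<^esub> \<tau> y"
begin

definition corr :: "('a \<Rightarrow> real) \<Rightarrow> ('a \<Rightarrow> real) \<Rightarrow> bool" where
  "corr f g \<longleftrightarrow> (\<forall>x. x \<notin> S \<longrightarrow> f x = 0) \<and> (\<forall>y. y \<notin> S' \<longrightarrow> g y = 0) \<and> (\<forall>x\<in>S. g (\<tau> x) = f x)"

lemma \<tau>_in: "x \<in> S \<Longrightarrow> \<tau> x \<in> S'"
  using bij by (auto simp: bij_betw_def)

lemma \<tau>_eq_iff: "x \<in> S \<Longrightarrow> y \<in> S \<Longrightarrow> \<tau> x = \<tau> y \<longleftrightarrow> x = y"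
  using bij by (auto simp: bij_betw_def inj_on_def)

lemma corr_norm:
  assumes "corr f g"
  shows "ell1_norm G f = ell1_norm H g"
proof -
  have "(\<Sum>\<^sub>\<infinity>x\<in>carrier G. \<bar>f x\<bar>) = (\<Sum>\<^sub>\<infinity>x\<in>S. \<bar>g (\<tau> x)\<bar>)"
    using assms S_sub by (intro infsum_cong_neutral) (auto simp: corr_def)
  also have "\<dots> = (\<Sum>\<^sub>\<infinity>y\<in>S'. \<bar>g y\<bar>)"
    by (rule infsum_reindex_bij_betw[OF bij])
  also have "\<dots> = (\<Sum>\<^sub>\<infinity>x\<in>carrier H. \<bar>g x\<bar>)"
    using assms S'_sub by (intro infsum_cong_neutral) (auto simp: corr_def)
  finally show ?thesis by (simp add: ell1_norm_def)
qed

lemma corr_summable_iff: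
  assumes "corr f g"
  shows "(\<lambda>x. \<bar>f x\<bar>) summable_on carrier G \<longleftrightarrow> (\<lambda>x. \<bar>g x\<bar>) summable_on carrier H"
proof -
  have "(\<lambda>x. \<bar>f x\<bar>) summable_on carrier G \<longleftrightarrow> (\<lambda>x. \<bar>g (\<tau> x)\<bar>) summable_on S"
    using assms S_sub by (intro summable_on_cong_neutral) (auto simp: corr_def)
  also have "\<dots> \<longleftrightarrow> (\<lambda>y. \<bar>g y\<bar>) summable_on S'"
    by (rule summable_on_reindex_bij_betw[OF bij])
  also have "\<dots> \<longleftrightarrow> (\<lambda>x. \<bar>g x\<bar>) summable_on carrier H"
    using assms S'_sub by (intro summable_on_cong_neutral) (auto simp: corr_def)
  finally show ?thesis .
qed

lemma corr_ball: "corr f g \<Longrightarrow> f \<in> cnv_univ (conv_algebra G) \<longleftrightarrow> g \<in> cnv_univ (conv_algebra H)"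
  using corr_summable_iff[of f g] corr_norm[of f g] S_sub S'_sub
  by (auto simp: conv_algebra_def ell1_def corr_def)

text \<open>The condition \<open>h 0 0 = 0\<close> keeps the results zero off \<open>S\<close> and
  \<open>S'\<close>. Sum, meet, join and difference are all instances.\<close>

lemma corr_pointwise:
  assumes "corr f g" "corr f' g'" "h 0 0 = 0"
  shows "corr (\<lambda>x. h (f x) (f' x)) (\<lambda>x. h (g x) (g' x))"
  using assms by (auto simp: corr_def)

end

lemma conv_algebra_sel [simp]:
  "cnv_zero (conv_algebra G) = (\<lambda>x. 0)"
  "cnv_plus (conv_algebra G) f g = (\<lambda>x. (f x + g x) / 2)"
  "cnv_meet (conv_algebra G) f g = (\<lambda>x. min (f x) (g x) / 2)"
  "cnv_join (conv_algebra G) f g = (\<lambda>x. max (f x) (g x) / 2)"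
  "cnv_star (conv_algebra G) = convolution G"
  "cnv_norm (conv_algebra G) = ell1_norm G"
  "cnv_dist (conv_algebra G) f g = ell1_norm G (\<lambda>x. f x - g x)"
  by (simp_all add: conv_algebra_def)

text \<open>All other summands vanish. The remaining indices are the first factors of the
  factorisations of \<open>x\<close> with both factors in \<open>S\<close>.\<close>

lemma (in group) convolution_factors:
  assumes "S \<subseteq> carrier G" "\<And>x. x \<notin> S \<Longrightarrow> f x = 0" "\<And>x. x \<notin> S \<Longrightarrow> f' x = 0" "x \<in> carrier G"
  shows "convolution G f f' x =
    (\<Sum>\<^sub>\<infinity>y\<in>{y \<in> S. inv\<^bsub>G\<^esub> y \<otimes>\<^bsub>G\<^esub> x \<in> S}. f y * f' (inv\<^bsub>G\<^esub> y \<otimes>\<^bsub>G\<^esub> x))"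
proof -
  have "f y * f' (inv\<^bsub>G\<^esub> y \<otimes>\<^bsub>G\<^esub> x) = 0" if "y \<notin> {y \<in> S. inv\<^bsub>G\<^esub> y \<otimes>\<^bsub>G\<^esub> x \<in> S}" for y
    using that assms(2)[of y] assms(3)[of "inv\<^bsub>G\<^esub> y \<otimes>\<^bsub>G\<^esub> x"] by auto
  then show ?thesis
    using assms(1,4) unfolding convolution_def by (subst if_P) (blast intro: infsum_cong_neutral)+
qed

context subsemigroup_iso begin

text \<open>A nonzero summand would write \<open>x\<close> as a product of two elements of
  \<open>S\<close>, against closure of \<open>S\<close>.\<close>

lemma convolution_zero_outside:
  assumes "\<And>x. x \<notin> S \<Longrightarrow> f x = 0" "\<And>x. x \<notin> S \<Longrightarrow> f' x = 0" "x \<notin> S"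
  shows "convolution G f f' x = 0"
proof (cases "x \<in> carrier G")
  case True
  have "y \<notin> S \<or> inv\<^bsub>G\<^esub> y \<otimes>\<^bsub>G\<^esub> x \<notin> S" for y
  proof (rule ccontr)
    assume "\<not> ?thesis"
    then have "y \<in> S" "y \<otimes>\<^bsub>G\<^esub> (inv\<^bsub>G\<^esub> y \<otimes>\<^bsub>G\<^esub> x) \<in> S" using S_mult by auto
    then show False
      using S_sub True assms(3) by (auto simp flip: G.m_assoc)
  qed
  then have empty: "{y \<in> S. inv\<^bsub>G\<^esub> y \<otimes>\<^bsub>G\<^esub> x \<in> S} = {}" by auto
  then show ?thesis
    using G.convolution_factors[OF S_sub, of f f' x] assms(1,2) True unfolding empty by simp
qed (simp add: convolution_def)

text \<open>This supplies closure of \<open>S'\<close> and makes facts proved for G available for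
  H.\<close>

lemma subsemigroup_iso_inverse: "subsemigroup_iso H G S' S (inv_into S \<tau>)"
proof unfold_locales
  show "bij_betw (inv_into S \<tau>) S' S" by (rule bij_betw_inv_into[OF bij])
  fix x' y' assume "x' \<in> S'" "y' \<in> S'"
  then obtain x y where xy: "x \<in> S" "y \<in> S" "x' = \<tau> x" "y' = \<tau> y"
    using bij by (auto simp: bij_betw_def)
  then have eq: "x' \<otimes>\<^bsub>H\<^esub> y' = \<tau> (x \<otimes>\<^bsub>G\<^esub> y)" by (simp add: \<tau>_mult)
  then show "x' \<otimes>\<^bsub>H\<^esub> y' \<in> S'" using xy S_mult \<tau>_in by auto
  have "inj_on \<tau> S" using bij by (simp add: bij_betw_def)
  then show "inv_into S \<tau> (x' \<otimes>\<^bsub>H\<^esub> y') = inv_into S \<tau> x' \<otimes>\<^bsub>G\<^esub> inv_into S \<tau> y'"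
    unfolding eq using xy S_mult by simp
qed (use S_sub S'_sub in auto)

text \<open>The map \<tau> carries the factorisations of \<open>x\<close> in \<open>S\<close>
  bijectively to those of \<open>\<tau> x\<close> in \<open>S'\<close>, and corresponding summands
  are equal.\<close>

lemma corr_convolution:
  assumes "corr f g" "corr f' g'"
  shows "corr (convolution G f f') (convolution H g g')"
proof -
  interpret inv: subsemigroup_iso H G S' S "inv_into S \<tau>" by (rule subsemigroup_iso_inverse)
  have "convolution H g g' (\<tau> x) = convolution G f f' x" if x: "x \<in> S" for x
  proof -
    define D where "D = {y \<in> S. inv\<^bsub>G\<^esub> y \<otimes>\<^bsub>G\<^esub> x \<in> S}"
    define D' where "D' = {y \<in> S'. inv\<^bsub>H\<^esub> y \<otimes>\<^bsub>H\<^esub> \<tau> x \<in> S'}"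
    have xc: "x \<in> carrier G" "\<tau> x \<in> carrier H" using x S_sub S'_sub \<tau>_in by auto
    \<comment> \<open>The inverse of \<open>y\<close> may lie outside \<open>S\<close>, where \<tau>
      says nothing. The equation is therefore rewritten as \<open>x\<close> being the product of
      \<open>y\<close> and \<open>z\<close>, which \<tau> respects in both directions.\<close>
    have Diff: "inv\<^bsub>H\<^esub> (\<tau> y) \<otimes>\<^bsub>H\<^esub> \<tau> x = \<tau> z \<longleftrightarrow> inv\<^bsub>G\<^esub> y \<otimes>\<^bsub>G\<^esub> x = z"
      if "y \<in> S" "z \<in> S" for y z
    proof -
      have c: "y \<in> carrier G" "z \<in> carrier G" "\<tau> y \<in> carrier H" "\<tau> z \<in> carrier H"
        using that S_sub S'_sub \<tau>_in by auto
      have "inv\<^bsub>H\<^esub> (\<tau> y) \<otimes>\<^bsub>H\<^esub> \<tau> x = \<tau> z \<longleftrightarrow> \<tau> x = \<tau> (y \<otimes>\<^bsub>G\<^esub> z)"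
        using c xc that by (simp add: \<tau>_mult H.inv_solve_left')
      also have "\<dots> \<longleftrightarrow> x = y \<otimes>\<^bsub>G\<^esub> z" using that x by (simp add: \<tau>_eq_iff S_mult)
      also have "\<dots> \<longleftrightarrow> inv\<^bsub>G\<^esub> y \<otimes>\<^bsub>G\<^esub> x = z"
        using c xc that by (simp add: G.inv_solve_left')
      finally show ?thesis .
    qed
    have "\<tau> ` D = D'"
    proof
      show "\<tau> ` D \<subseteq> D'"
      proof
        fix y' assume "y' \<in> \<tau> ` D"
        then obtain y where y: "y' = \<tau> y" "y \<in> S" "inv\<^bsub>G\<^esub> y \<otimes>\<^bsub>G\<^esub> x \<in> S" by (auto simp: D_def)
        then show "y' \<in> D'"
          using Diff[of y "inv\<^bsub>G\<^esub> y \<otimes>\<^bsub>G\<^esub> x"] \<tau>_in by (simp add: D'_def)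
      qed
      show "D' \<subseteq> \<tau> ` D"
      proof
        fix y' assume y': "y' \<in> D'"
        then obtain y z where yz: "y \<in> S" "z \<in> S" "y' = \<tau> y" "inv\<^bsub>H\<^esub> y' \<otimes>\<^bsub>H\<^esub> \<tau> x = \<tau> z"
          using bij unfolding D'_def bij_betw_def by blast
        then show "y' \<in> \<tau> ` D" using Diff by (auto simp: D_def)
      qed
    qed
    then have "bij_betw \<tau> D D'"
      using bij by (auto simp: D_def bij_betw_def intro: inj_on_subset)
    then have "(\<Sum>\<^sub>\<infinity>y\<in>D'. g y * g' (inv\<^bsub>H\<^esub> y \<otimes>\<^bsub>H\<^esub> \<tau> x)) =
        (\<Sum>\<^sub>\<infinity>y\<in>D. g (\<tau> y) * g' (inv\<^bsub>H\<^esub> (\<tau> y) \<otimes>\<^bsub>H\<^esub> \<tau> x))"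
      by (rule infsum_reindex_bij_betw[symmetric])
    also have "\<dots> = (\<Sum>\<^sub>\<infinity>y\<in>D. f y * f' (inv\<^bsub>G\<^esub> y \<otimes>\<^bsub>G\<^esub> x))"
    proof (rule infsum_cong)
      fix y assume "y \<in> D"
      then show "g (\<tau> y) * g' (inv\<^bsub>H\<^esub> (\<tau> y) \<otimes>\<^bsub>H\<^esub> \<tau> x) = f y * f' (inv\<^bsub>G\<^esub> y \<otimes>\<^bsub>G\<^esub> x)"
        using assms Diff[of y "inv\<^bsub>G\<^esub> y \<otimes>\<^bsub>G\<^esub> x"] by (auto simp: D_def corr_def)
    qed
    finally show ?thesis
      using assms xc G.convolution_factors[OF S_sub, of f f' x]
        H.convolution_factors[OF S'_sub, of g g' "\<tau> x"]
      by (simp add: corr_def D_def D'_def)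
  qed
  then show ?thesis
    using assms convolution_zero_outside[of f f'] inv.convolution_zero_outside[of g g']
    by (simp add: corr_def)
qed

lemma corr_term_val:
  assumes "\<And>i. corr (v i) (w i)"
  shows "corr (cnv_term_val (conv_algebra G) t v) (cnv_term_val (conv_algebra H) t w)"
proof (induction t)
  case (CPlus s t)
  then show ?case
    using corr_pointwise[of _ _ _ _ "\<lambda>x y. (x + y) / 2"] by simp
next
  case (CMeet s t)
  then show ?case
    using corr_pointwise[of _ _ _ _ "\<lambda>x y. min x y / 2"] by simp
next
  case (CJoin s t)
  then show ?case
    using corr_pointwise[of _ _ _ _ "\<lambda>x y. max x y / 2"] by simp
next
  case (CStar s t)
  then show ?case using corr_convolution by simp
qed (use assms in \<open>auto simp: corr_def\<close>)

lemma corr_dist: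
  assumes "corr f g" "corr f' g'"
  shows "cnv_dist (conv_algebra G) f f' = cnv_dist (conv_algebra H) g g'"
  using corr_norm[OF corr_pointwise[OF assms, of "\<lambda>x y. x - y"]] by simp

end

section \<open>The isomorphism induced by tuples of the same type\<close>

lemma word_vals_sub:
  assumes "group G" "range a \<subseteq> carrier G"
  shows "word_vals G k a \<subseteq> carrier G"
proof -
  have "grp_term_params t = {} \<Longrightarrow> grp_term_val G t a \<in> carrier G" for t
    using assms by (induction t) (auto intro: monoid.m_closed group.is_monoid)
  then show ?thesis by (auto simp: word_vals_def grp_words_def)
qed

definition word_map ::
    "('a, 'm) monoid_scheme \<Rightarrow> ('a, 'n) monoid_scheme \<Rightarrow> nat \<Rightarrow> (nat \<Rightarrow> 'a) \<Rightarrow> (nat \<Rightarrow> 'a) \<Rightarrow> 'a \<Rightarrow> 'a" where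
  "word_map G H k a b x = grp_term_val H (SOME t. t \<in> grp_words k \<and> grp_term_val G t a = x) b"

text \<open>The term chosen by \<open>SOME\<close> has the same value at \<open>a\<close> as
  \<open>t\<close>, hence also the same value at \<open>b\<close>, because the types agree.\<close>

lemma word_map_val:
  assumes "same_type G H k a b" "t \<in> grp_words k"
  shows "word_map G H k a b (grp_term_val G t a) = grp_term_val H t b"
proof -
  let ?P = "\<lambda>s. s \<in> grp_words k \<and> grp_term_val G s a = grp_term_val G t a"
  have "?P (SOME s. ?P s)" by (rule someI[of ?P t]) (simp add: assms(2))
  then show ?thesis
    unfolding word_map_def using same_type_word_eq_iff[OF assms(1) _ assms(2)] by metis
qed

text \<open>Products of words are words, which gives closure and multiplicativity; injectivity is
  the direction from \<open>b\<close> to \<open>a\<close> of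
  \<open>same_type_word_eq_iff\<close>.\<close>

lemma same_type_imp_iso:
  assumes "group G" "group H" "same_type G H k a b"
  shows "subsemigroup_iso G H (word_vals G k a) (word_vals H k b) (word_map G H k a b)"
proof -
  interpret G: group G by fact
  interpret H: group H by fact
  have GMult: "GMult s t \<in> grp_words k" if "s \<in> grp_words k" "t \<in> grp_words k" for s t :: "'a grp_term"
    using that by (auto simp: grp_words_def)
  show ?thesis
  proof unfold_locales
    show "word_vals G k a \<subseteq> carrier G" "word_vals H k b \<subseteq> carrier H"
      using assms word_vals_sub by (auto simp: same_type_def)
    show "bij_betw (word_map G H k a b) (word_vals G k a) (word_vals H k b)"
      using same_type_word_eq_iff[OF assms(3)]
      by (auto simp: bij_betw_def inj_on_def word_vals_def word_map_val[OF assms(3)] image_image)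
    fix x y assume "x \<in> word_vals G k a" "y \<in> word_vals G k a"
    then obtain s t where st: "s \<in> grp_words k" "t \<in> grp_words k"
      "x = grp_term_val G s a" "y = grp_term_val G t a" by (auto simp: word_vals_def)
    then have xy: "x \<otimes>\<^bsub>G\<^esub> y = grp_term_val G (GMult s t) a" by simp
    then show "x \<otimes>\<^bsub>G\<^esub> y \<in> word_vals G k a"
      using GMult st(1,2) unfolding word_vals_def by blast
    show "word_map G H k a b (x \<otimes>\<^bsub>G\<^esub> y) = word_map G H k a b x \<otimes>\<^bsub>H\<^esub> word_map G H k a b y"
      using st word_map_val[OF assms(3) GMult[OF st(1,2)]] word_map_val[OF assms(3)] by simp
  qed
qed

section \<open>The norm on the unit ball\<close>

abbreviation cnv_ball :: "('a, 'm) monoid_scheme \<Rightarrow> ('a \<Rightarrow> real) set" where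
  "cnv_ball G \<equiv> cnv_univ (conv_algebra G)"

abbreviation ell1_dist :: "('a, 'm) monoid_scheme \<Rightarrow> ('a \<Rightarrow> real) \<Rightarrow> ('a \<Rightarrow> real) \<Rightarrow> real" where
  "ell1_dist G f g \<equiv> ell1_norm G (\<lambda>x. f x - g x)"

lemma cnv_ball_iff: "f \<in> cnv_ball G \<longleftrightarrow> f \<in> ell1 G \<and> ell1_norm G f \<le> 1"
  by (simp add: conv_algebra_def)

lemma ell1_norm_nonneg: "0 \<le> ell1_norm G f"
  unfolding ell1_norm_def by (rule infsum_nonneg) simp

lemma ell1_outside: "f \<in> ell1 G \<Longrightarrow> x \<notin> carrier G \<Longrightarrow> f x = 0"
  by (simp add: ell1_def)

lemma ell1_summable: "f \<in> ell1 G \<Longrightarrow> (\<lambda>x. \<bar>f x\<bar>) summable_on carrier G"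
  by (simp add: ell1_def)

lemma zero_in_cnv_ball: "(\<lambda>x. 0) \<in> cnv_ball G"
  by (simp add: cnv_ball_iff ell1_def ell1_norm_def)

text \<open>This comparison underlies most norm estimates below: \<open>c = 1\<close> for
  differences and triangle inequalities, \<open>c = 1/2\<close> for the rescaled lattice
  operations.\<close>

lemma ell1_dominated:
  assumes f: "f \<in> ell1 G" and g: "g \<in> ell1 G" and c: "0 \<le> c"
    and h: "\<And>x. \<bar>h x\<bar> \<le> c * (\<bar>f x\<bar> + \<bar>g x\<bar>)"
  shows "h \<in> ell1 G" "ell1_norm G h \<le> c * (ell1_norm G f + ell1_norm G g)"
proof -
  have s: "(\<lambda>x. \<bar>f x\<bar> + \<bar>g x\<bar>) summable_on carrier G"
    by (intro summable_on_add ell1_summable f g)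
  then have s': "(\<lambda>x. c * (\<bar>f x\<bar> + \<bar>g x\<bar>)) summable_on carrier G"
    by (rule summable_on_cmult_right)
  then have sh: "(\<lambda>x. \<bar>h x\<bar>) summable_on carrier G"
    by (rule summable_on_comparison_test) (auto intro: h)
  moreover have "h x = 0" if "x \<notin> carrier G" for x
    using h[of x] ell1_outside[OF f that] ell1_outside[OF g that] by simp
  ultimately show "h \<in> ell1 G" by (simp add: ell1_def)
  have "ell1_norm G h \<le> (\<Sum>\<^sub>\<infinity>x\<in>carrier G. c * (\<bar>f x\<bar> + \<bar>g x\<bar>))"
    unfolding ell1_norm_def by (rule infsum_mono[OF sh s']) (rule h)
  also have "\<dots> = c * (ell1_norm G f + ell1_norm G g)"
    unfolding ell1_norm_def
    by (simp add: infsum_cmult_right' infsum_add ell1_summable f g)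
  finally show "ell1_norm G h \<le> c * (ell1_norm G f + ell1_norm G g)" .
qed

lemma ell1_diff: "f \<in> ell1 G \<Longrightarrow> g \<in> ell1 G \<Longrightarrow> (\<lambda>x. f x - g x) \<in> ell1 G"
  by (rule ell1_dominated(1)[where c = 1 and f = f and g = g]) auto

lemma ell1_dist_commute: "ell1_dist G f g = ell1_dist G g f"
  by (simp add: ell1_norm_def abs_minus_commute)

lemma ell1_dist_triangle:
  assumes "f \<in> ell1 G" "g \<in> ell1 G" "h \<in> ell1 G"
  shows "ell1_dist G f h \<le> ell1_dist G f g + ell1_dist G g h"
  using ell1_dominated(2)[where c = 1, OF ell1_diff[OF assms(1,2)] ell1_diff[OF assms(2,3)],
      of "\<lambda>x. f x - h x"] by auto

text \<open>The factor 1/2 is that of the rescaled operations; it keeps the norm at most (1 +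
  1)/2.\<close>

lemma cnv_ball_pointwise:
  assumes "f \<in> cnv_ball G" "g \<in> cnv_ball G" "\<And>x. \<bar>h x\<bar> \<le> 1/2 * (\<bar>f x\<bar> + \<bar>g x\<bar>)"
  shows "h \<in> cnv_ball G"
  using assms ell1_dominated[of f G g "1/2" h] by (auto simp: cnv_ball_iff)

text \<open>The sharp factor would be 1/2; the factor 1 agrees with the bound for convolution, so
  that all four binary operations can be treated alike.\<close>

lemma half_op_diff_le:
  fixes a b c d :: real
  shows "\<bar>(a + b) / 2 - (c + d) / 2\<bar> \<le> \<bar>a - c\<bar> + \<bar>b - d\<bar>"
    "\<bar>min a b / 2 - min c d / 2\<bar> \<le> \<bar>a - c\<bar> + \<bar>b - d\<bar>"
    "\<bar>max a b / 2 - max c d / 2\<bar> \<le> \<bar>a - c\<bar> + \<bar>b - d\<bar>"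
  by argo (simp add: min_def max_def; argo)+

lemma ell1_dist_pointwise:
  assumes "f \<in> cnv_ball G" "g \<in> cnv_ball G" "f' \<in> cnv_ball G" "g' \<in> cnv_ball G"
    and "\<And>x. \<bar>h x - h' x\<bar> \<le> 1 * (\<bar>f x - f' x\<bar> + \<bar>g x - g' x\<bar>)"
  shows "ell1_dist G h h' \<le> ell1_dist G f f' + ell1_dist G g g'"
proof -
  have "ell1_dist G h h' \<le> 1 * (ell1_dist G f f' + ell1_dist G g g')"
    by (rule ell1_dominated(2)[OF ell1_diff ell1_diff _ assms(5)])
      (use assms(1-4) in \<open>simp_all add: cnv_ball_iff\<close>)
  then show ?thesis by simp
qed

section \<open>Convolution and Lipschitz bounds for terms\<close>

definition cnv_Lipschitz :: "('a, 'm) monoid_scheme \<Rightarrow> cnv_term \<Rightarrow> nat \<Rightarrow> real \<Rightarrow> bool" where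
  "cnv_Lipschitz G t N K \<longleftrightarrow> 0 \<le> K \<and>
     (\<forall>v w \<delta>. range v \<subseteq> cnv_ball G \<longrightarrow> range w \<subseteq> cnv_ball G \<longrightarrow> 0 \<le> \<delta> \<longrightarrow>
       (\<forall>i<N. ell1_dist G (v i) (w i) \<le> \<delta>) \<longrightarrow>
       ell1_dist G (cnv_term_val (conv_algebra G) t v) (cnv_term_val (conv_algebra G) t w) \<le> K * \<delta>)"

lemma cnv_LipschitzD:
  assumes "cnv_Lipschitz G t N K" "range v \<subseteq> cnv_ball G" "range w \<subseteq> cnv_ball G" "0 \<le> \<delta>"
    "\<And>i. i < N \<Longrightarrow> ell1_dist G (v i) (w i) \<le> \<delta>"
  shows "ell1_dist G (cnv_term_val (conv_algebra G) t v) (cnv_term_val (conv_algebra G) t w) \<le> K * \<delta>"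
  using assms unfolding cnv_Lipschitz_def by blast

context group begin

text \<open>Fubini for the family \<open>h\<close> on pairs: summing over \<open>x\<close> first,
  translation invariance gives \<open>\<bar>f y\<bar>\<close> times the norm of \<open>g\<close>,
  which is summable in \<open>y\<close>.\<close>

lemma convolution_ell1:
  assumes f: "f \<in> ell1 G" and g: "g \<in> ell1 G"
  shows "convolution G f g \<in> ell1 G"
    and "ell1_norm G (convolution G f g) \<le> ell1_norm G f * ell1_norm G g"
    and "x \<in> carrier G \<Longrightarrow> (\<lambda>y. f y * g (inv y \<otimes> x)) summable_on carrier G"
proof -
  define h where "h = (\<lambda>(y, x). f y * g (inv y \<otimes> x))"
  let ?C = "carrier G"
  have bij: "bij_betw (\<lambda>x. inv y \<otimes> x) ?C ?C" if "y \<in> ?C" for y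
    using that
    by (intro bij_betw_byWitness[where f' = "\<lambda>x. y \<otimes> x"]) (auto simp flip: m_assoc)
  have gs: "(\<lambda>x. \<bar>g (inv y \<otimes> x)\<bar>) summable_on ?C" if "y \<in> ?C" for y
    using summable_on_reindex_bij_betw[OF bij[OF that], of "\<lambda>x. \<bar>g x\<bar>"] ell1_summable[OF g] by simp
  have gn: "(\<Sum>\<^sub>\<infinity>x\<in>?C. \<bar>g (inv y \<otimes> x)\<bar>) = ell1_norm G g" if "y \<in> ?C" for y
    using infsum_reindex_bij_betw[OF bij[OF that], of "\<lambda>x. \<bar>g x\<bar>"] by (simp add: ell1_norm_def)
  have inner: "(\<Sum>\<^sub>\<infinity>x\<in>?C. \<bar>h (y, x)\<bar>) = \<bar>f y\<bar> * ell1_norm G g" if "y \<in> ?C" for y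
    by (simp add: h_def abs_mult infsum_cmult_right' gn that)
  have "(\<lambda>x. norm (h (y, x))) summable_on ?C" if "y \<in> ?C" for y
    using gs[OF that] by (simp add: h_def abs_mult summable_on_cmult_right)
  moreover have "(\<lambda>y. norm (\<Sum>\<^sub>\<infinity>x\<in>?C. norm (h (y, x)))) summable_on ?C
      \<longleftrightarrow> (\<lambda>y. \<bar>f y\<bar> * ell1_norm G g) summable_on ?C"
    by (rule summable_on_cong) (simp add: inner ell1_norm_nonneg)
  ultimately have hs: "(\<lambda>p. norm (h p)) summable_on (?C \<times> ?C)"
    unfolding Infinite_Sum.abs_summable_on_Sigma_iff
    using summable_on_cmult_left[OF ell1_summable[OF f]] by auto
  \<comment> \<open>After the swap \<open>x\<close> is the outer variable, so the same criterion
    yields absolute convergence of the convolution sum at each \<open>x\<close> and summability of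
    its bounds over \<open>x\<close>.\<close>
  then have "(\<lambda>p. norm ((h \<circ> prod.swap) p)) summable_on (?C \<times> ?C)"
    using summable_on_reindex_bij_betw[of prod.swap "?C \<times> ?C" "?C \<times> ?C" "\<lambda>p. norm (h p)"]
    by (simp add: product_swap bij_betw_def)
  then have "\<forall>x\<in>?C. (\<lambda>y. norm (h (y, x))) summable_on ?C"
    and s2: "(\<lambda>x. \<Sum>\<^sub>\<infinity>y\<in>?C. \<bar>h (y, x)\<bar>) summable_on ?C"
    unfolding Infinite_Sum.abs_summable_on_Sigma_iff by (auto simp: infsum_nonneg)
  then have s1: "(\<lambda>y. norm (h (y, x))) summable_on ?C" if "x \<in> ?C" for x
    using that by blast
  show "x \<in> ?C \<Longrightarrow> (\<lambda>y. f y * g (inv y \<otimes> x)) summable_on ?C"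
    using abs_summable_summable[OF s1] by (simp add: h_def)
  have le: "\<bar>convolution G f g x\<bar> \<le> (\<Sum>\<^sub>\<infinity>y\<in>?C. \<bar>h (y, x)\<bar>)" if "x \<in> ?C" for x
    using norm_infsum_bound[OF s1[OF that]] that by (simp add: convolution_def h_def)
  have cs: "(\<lambda>x. \<bar>convolution G f g x\<bar>) summable_on ?C"
    by (rule summable_on_comparison_test[OF s2]) (auto intro: le)
  then show "convolution G f g \<in> ell1 G"
    by (simp add: ell1_def convolution_def)
  have "ell1_norm G (convolution G f g) \<le> (\<Sum>\<^sub>\<infinity>x\<in>?C. \<Sum>\<^sub>\<infinity>y\<in>?C. \<bar>h (y, x)\<bar>)"
    unfolding ell1_norm_def by (rule infsum_mono[OF cs s2 le])
  also have "\<dots> = (\<Sum>\<^sub>\<infinity>y\<in>?C. \<Sum>\<^sub>\<infinity>x\<in>?C. \<bar>h (y, x)\<bar>)"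
    by (rule infsum_swap_banach[symmetric]) (use hs in \<open>simp add: case_prod_unfold\<close>)
  also have "\<dots> = (\<Sum>\<^sub>\<infinity>y\<in>?C. \<bar>f y\<bar> * ell1_norm G g)"
    by (rule infsum_cong) (rule inner)
  also have "\<dots> = ell1_norm G f * ell1_norm G g"
    by (simp add: infsum_cmult_left' ell1_norm_def)
  finally show "ell1_norm G (convolution G f g) \<le> ell1_norm G f * ell1_norm G g" .
qed

lemma convolution_diff:
  assumes "f \<in> ell1 G" "g \<in> ell1 G" "f' \<in> ell1 G" "g' \<in> ell1 G"
  shows "convolution G f g x - convolution G f' g' x =
    convolution G (\<lambda>x. f x - f' x) g x + convolution G f' (\<lambda>x. g x - g' x) x"
proof (cases "x \<in> carrier G")
  case True
  note s = convolution_ell1(3)[OF _ _ True]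
  have "convolution G f g x = (\<Sum>\<^sub>\<infinity>y\<in>carrier G. (f y - f' y) * g (inv y \<otimes> x) +
      (f' y * (g (inv y \<otimes> x) - g' (inv y \<otimes> x)) + f' y * g' (inv y \<otimes> x)))"
    using True by (simp add: convolution_def algebra_simps)
  also have "\<dots> = convolution G (\<lambda>x. f x - f' x) g x +
      (convolution G f' (\<lambda>x. g x - g' x) x + convolution G f' g' x)"
    using True s[OF ell1_diff[OF assms(1,3)] assms(2)] s[OF assms(3,4)]
      s[OF assms(3) ell1_diff[OF assms(2,4)]]
    by (simp add: convolution_def infsum_add summable_on_add)
  finally show ?thesis by simp
qed (simp add: convolution_def)

text \<open>Being bilinear, convolution is Lipschitz on bounded sets; in the splitting of
  \<open>convolution_diff\<close> the undifferenced factors \<open>g\<close> and \<open>f'\<close>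
  have norm at most 1, whence the constant 1.\<close>

lemma convolution_dist:
  assumes "f \<in> cnv_ball G" "g \<in> cnv_ball G" "f' \<in> cnv_ball G" "g' \<in> cnv_ball G"
  shows "ell1_dist G (convolution G f g) (convolution G f' g') \<le> ell1_dist G f f' + ell1_dist G g g'"
proof -
  have e: "f \<in> ell1 G" "g \<in> ell1 G" "f' \<in> ell1 G" "g' \<in> ell1 G"
    and n: "ell1_norm G g \<le> 1" "ell1_norm G f' \<le> 1"
    using assms by (auto simp: cnv_ball_iff)
  let ?p = "convolution G (\<lambda>x. f x - f' x) g" and ?q = "convolution G f' (\<lambda>x. g x - g' x)"
  have "ell1_dist G (convolution G f g) (convolution G f' g') \<le> 1 * (ell1_norm G ?p + ell1_norm G ?q)"
    by (rule ell1_dominated(2))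
      (auto intro!: convolution_ell1 ell1_diff e simp: convolution_diff e abs_triangle_ineq)
  moreover have "ell1_norm G ?p \<le> ell1_dist G f f'"
    using convolution_ell1(2)[OF ell1_diff[OF e(1,3)] e(2)]
      mult_left_mono[OF n(1) ell1_norm_nonneg[of G "\<lambda>x. f x - f' x"]] by simp
  moreover have "ell1_norm G ?q \<le> ell1_dist G g g'"
    using convolution_ell1(2)[OF e(3) ell1_diff[OF e(2,4)]]
      mult_right_mono[OF n(2) ell1_norm_nonneg[of G "\<lambda>x. g x - g' x"]] by simp
  ultimately show ?thesis by simp
qed

lemma convolution_ball:
  assumes "f \<in> cnv_ball G" "g \<in> cnv_ball G"
  shows "convolution G f g \<in> cnv_ball G"
  using assms convolution_ell1[of f g] mult_le_one[of "ell1_norm G f" "ell1_norm G g"]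
  by (auto simp: cnv_ball_iff ell1_norm_nonneg)

lemma cnv_term_val_ball:
  assumes "range v \<subseteq> cnv_ball G"
  shows "cnv_term_val (conv_algebra G) t v \<in> cnv_ball G"
proof (induction t)
  case CZero
  then show ?case using zero_in_cnv_ball by simp
next
  case (CPlus s t)
  from cnv_ball_pointwise[OF this] show ?case by simp
next
  case (CMeet s t)
  from cnv_ball_pointwise[OF this] show ?case by (simp add: min_def)
next
  case (CJoin s t)
  from cnv_ball_pointwise[OF this] show ?case by (simp add: max_def)
next
  case (CStar s t)
  from convolution_ball[OF this] show ?case by simp
qed (use assms in auto)

text \<open>With the constructor as a variable \<open>c\<close>, the induction on terms needs one
  argument for all four binary operations.\<close>

lemma cnv_term_val_op_dist:
  assumes v: "range v \<subseteq> cnv_ball G" and w: "range w \<subseteq> cnv_ball G"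
    and "c \<in> {CPlus, CMeet, CJoin, CStar}"
  shows "ell1_dist G (cnv_term_val (conv_algebra G) (c s t) v) (cnv_term_val (conv_algebra G) (c s t) w)
    \<le> ell1_dist G (cnv_term_val (conv_algebra G) s v) (cnv_term_val (conv_algebra G) s w)
      + ell1_dist G (cnv_term_val (conv_algebra G) t v) (cnv_term_val (conv_algebra G) t w)"
proof -
  note b = cnv_term_val_ball[OF v, of s] cnv_term_val_ball[OF v, of t]
    cnv_term_val_ball[OF w, of s] cnv_term_val_ball[OF w, of t]
  from assms(3) consider "c = CPlus" | "c = CMeet" | "c = CJoin" | "c = CStar" by auto
  then show ?thesis
  proof cases
    case 1
    show ?thesis
      by (rule ell1_dist_pointwise[OF b]) (simp add: 1 half_op_diff_le)
  next
    case 2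
    show ?thesis
      by (rule ell1_dist_pointwise[OF b])
        (simp add: 2 half_op_diff_le)
  next
    case 3
    show ?thesis
      by (rule ell1_dist_pointwise[OF b])
        (simp add: 3 half_op_diff_le)
  next
    case 4
    show ?thesis using convolution_dist[OF b] by (simp add: 4)
  qed
qed

text \<open>Constants add up along the term. For the variable \<open>j\<close> the bound is
  \<open>N = Suc j\<close>, since only indices strictly below \<open>N\<close> are
  controlled.\<close>

lemma cnv_term_val_Lipschitz: "\<exists>N K. cnv_Lipschitz G t N K"
proof (induction t)
  case (CVar j)
  show ?case by (intro exI[of _ "Suc j"] exI[of _ 1]) (auto simp: cnv_Lipschitz_def)
next
  case CZero
  show ?case by (intro exI[of _ 0]) (simp add: cnv_Lipschitz_def ell1_norm_def)
next
  have step: "\<exists>N K. cnv_Lipschitz G (c s t) N K"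
    if "\<exists>N K. cnv_Lipschitz G s N K" "\<exists>N K. cnv_Lipschitz G t N K"
      "c \<in> {CPlus, CMeet, CJoin, CStar}" for c s t
  proof -
    from that(1) obtain N K where 1: "cnv_Lipschitz G s N K" by blast
    from that(2) obtain N' K' where 2: "cnv_Lipschitz G t N' K'" by blast
    have "cnv_Lipschitz G (c s t) (max N N') (K + K')"
      unfolding cnv_Lipschitz_def
    proof (intro conjI allI impI)
      show "0 \<le> K + K'" using 1 2 by (simp add: cnv_Lipschitz_def)
      fix v w \<delta>
      assume v: "range v \<subseteq> cnv_ball G" "range w \<subseteq> cnv_ball G"
        and d: "(0::real) \<le> \<delta>" "\<forall>i<max N N'. ell1_dist G (v i) (w i) \<le> \<delta>"
      show "ell1_dist G (cnv_term_val (conv_algebra G) (c s t) v)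
          (cnv_term_val (conv_algebra G) (c s t) w) \<le> (K + K') * \<delta>"
        using cnv_LipschitzD[OF 1 v d(1)] cnv_LipschitzD[OF 2 v d(1)] d(2)
          cnv_term_val_op_dist[OF v that(3), of s t]
        by (simp add: distrib_right)
    qed
    then show ?thesis by blast
  qed
  {
    case (CPlus s t)
    then show ?case using step by blast
  next
    case (CMeet s t)
    then show ?case using step by blast
  next
    case (CJoin s t)
    then show ?case using step by blast
  next
    case (CStar s t)
    then show ?case using step by blast
  }
qed

end

text \<open>The approximation is the restriction of \<open>f\<close> to a finite set. It stays in
  the ball, and the norm of \<open>f\<close> is exactly the sum of the norms of the restriction and
  of the remainder, so a good finite partial sum makes the remainder small.\<close>

lemma finite_support_dense:
  assumes f: "f \<in> cnv_ball G" and "0 < \<epsilon>"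
  shows "\<exists>F f'. finite F \<and> F \<subseteq> carrier G \<and> f' \<in> cnv_ball G \<and> (\<forall>x. x \<notin> F \<longrightarrow> f' x = 0) \<and>
    ell1_dist G f f' \<le> \<epsilon>"
proof -
  have fe: "f \<in> ell1 G" using f by (simp add: cnv_ball_iff)
  obtain F where F: "finite F" "F \<subseteq> carrier G"
    "dist (\<Sum>x\<in>F. \<bar>f x\<bar>) (ell1_norm G f) \<le> \<epsilon>"
    using infsum_finite_approximation[OF ell1_summable[OF fe] \<open>0 < \<epsilon>\<close>] by (auto simp: ell1_norm_def)
  define f' where "f' = (\<lambda>x. if x \<in> F then f x else 0)"
  have f'e: "f' \<in> ell1 G" and f'n: "ell1_norm G f' \<le> ell1_norm G f"
    using ell1_dominated[OF fe, of "\<lambda>x. 0" 1 f'] zero_in_cnv_ball[of G]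
    by (simp_all add: f'_def cnv_ball_iff ell1_norm_def)
  have "ell1_norm G f' = (\<Sum>\<^sub>\<infinity>x\<in>F. \<bar>f x\<bar>)"
    unfolding ell1_norm_def using F by (intro infsum_cong_neutral) (auto simp: f'_def)
  then have "ell1_norm G f' = (\<Sum>x\<in>F. \<bar>f x\<bar>)" using F by simp
  moreover have "ell1_norm G f = ell1_dist G f f' + ell1_norm G f'"
  proof -
    have "ell1_norm G f = (\<Sum>\<^sub>\<infinity>x\<in>carrier G. \<bar>f x - f' x\<bar> + \<bar>f' x\<bar>)"
      unfolding ell1_norm_def by (rule infsum_cong) (simp add: f'_def)
    then show ?thesis
      unfolding ell1_norm_def by (simp add: infsum_add ell1_summable ell1_diff fe f'e)
  qed
  ultimately have "ell1_dist G f f' \<le> \<epsilon>" using F(3) by (simp add: dist_real_def)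
  then show ?thesis
    using F(1,2) f f'e f'n
    by (intro exI[of _ F] exI[of _ f']) (auto simp: cnv_ball_iff f'_def)
qed

section \<open>Uniform continuity of formulas\<close>

lemma SUP_diff_le:
  fixes f :: "'b \<Rightarrow> real" and g :: "'c \<Rightarrow> real"
  assumes "A \<noteq> {}" "bdd_above (g ` B)" "\<And>a. a \<in> A \<Longrightarrow> \<exists>b\<in>B. f a \<le> g b + \<epsilon>"
  shows "(SUP a\<in>A. f a) \<le> (SUP b\<in>B. g b) + \<epsilon>"
proof (rule cSUP_least[OF assms(1)])
  fix a assume "a \<in> A"
  then obtain b where "b \<in> B" "f a \<le> g b + \<epsilon>" using assms(3) by blast
  then show "f a \<le> (SUP b\<in>B. g b) + \<epsilon>"
    using cSUP_upper[OF _ assms(2), of b] by linarith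
qed

text \<open>The index sets may differ because \<open>A\<close> and \<open>B\<close> will be the unit
  balls of two groups; witnesses are matched both ways instead of comparing functions
  pointwise.\<close>

lemma SUP_INF_close:
  fixes f :: "'b \<Rightarrow> real" and g :: "'c \<Rightarrow> real"
  assumes ne: "A \<noteq> {}" "B \<noteq> {}"
    and bd: "\<And>a. a \<in> A \<Longrightarrow> \<bar>f a\<bar> \<le> K" "\<And>b. b \<in> B \<Longrightarrow> \<bar>g b\<bar> \<le> L"
    and fg: "\<And>a. a \<in> A \<Longrightarrow> \<exists>b\<in>B. \<bar>f a - g b\<bar> \<le> \<epsilon>"
    and gf: "\<And>b. b \<in> B \<Longrightarrow> \<exists>a\<in>A. \<bar>f a - g b\<bar> \<le> \<epsilon>"
  shows "\<bar>(SUP a\<in>A. f a) - (SUP b\<in>B. g b)\<bar> \<le> \<epsilon>" "\<bar>(INF a\<in>A. f a) - (INF b\<in>B. g b)\<bar> \<le> \<epsilon>"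
proof -
  \<comment> \<open>The sign -1 covers infima, as negatives of suprema of negatives.\<close>
  have main: "\<bar>(SUP a\<in>A. s * f a) - (SUP b\<in>B. s * g b)\<bar> \<le> \<epsilon>" if s: "s = 1 \<or> s = -1" for s :: real
  proof -
    have "bdd_above ((\<lambda>b. s * g b) ` B)"
      using bd(2) s by (auto intro!: bdd_aboveI2[where M = L] simp: abs_le_iff)
    moreover have "bdd_above ((\<lambda>a. s * f a) ` A)"
      using bd(1) s by (auto intro!: bdd_aboveI2[where M = K] simp: abs_le_iff)
    moreover have "\<exists>b\<in>B. s * f a \<le> s * g b + \<epsilon>" if "a \<in> A" for a
      using fg[OF that] s by (elim bexE, intro bexI) (auto simp: abs_le_iff)
    moreover have "\<exists>a\<in>A. s * g b \<le> s * f a + \<epsilon>" if "b \<in> B" for b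
      using gf[OF that] s by (elim bexE, intro bexI) (auto simp: abs_le_iff)
    ultimately have "(SUP a\<in>A. s * f a) \<le> (SUP b\<in>B. s * g b) + \<epsilon>"
      "(SUP b\<in>B. s * g b) \<le> (SUP a\<in>A. s * f a) + \<epsilon>"
      by (simp_all add: SUP_diff_le ne)
    then show ?thesis by linarith
  qed
  show "\<bar>(SUP a\<in>A. f a) - (SUP b\<in>B. g b)\<bar> \<le> \<epsilon>" using main[of 1] by simp
  show "\<bar>(INF a\<in>A. f a) - (INF b\<in>B. g b)\<bar> \<le> \<epsilon>"
    using main[of "-1"] by (simp add: Inf_real_def image_image abs_minus_commute)
qed

text \<open>Tychonoff's theorem. On such a box every continuous connective is bounded and uniformly
  continuous.\<close>

lemma compact_box: "compact {x :: nat \<Rightarrow> real. \<forall>i. \<bar>x i\<bar> \<le> B}"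
proof -
  have "compactin (product_topology (\<lambda>i. euclidean) UNIV) (PiE UNIV (\<lambda>i::nat. {-B..B}))"
    by (simp add: compactin_PiE)
  moreover have "PiE UNIV (\<lambda>i::nat. {-B..B}) = {x. \<forall>i. \<bar>x i\<bar> \<le> B}"
    by (auto simp: PiE_def Pi_def abs_le_iff minus_le_iff)
  ultimately show ?thesis by (simp add: euclidean_product_topology)
qed

text \<open>The metric on sequences sums the coordinate distances, cut off at 1, with weights
  \<open>(1/2) ^ n\<close>; the constant 2 is the total weight.\<close>

lemma dist_fun_le:
  fixes x y :: "nat \<Rightarrow> real"
  assumes "\<And>i. \<bar>x i - y i\<bar> \<le> \<delta>"
  shows "dist x y \<le> 2 * \<delta>"
proof -
  have 0: "0 \<le> \<delta>" using assms[of 0] by linarith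
  have s: "summable (\<lambda>n. (1/2) ^ n * \<delta> :: real)" by (intro summable_mult2 summable_geometric) simp
  have le: "(1/2)^n * min (dist (x (from_nat n)) (y (from_nat n))) 1 \<le> (1/2)^n * \<delta>" for n
    using assms[of "from_nat n"] by (intro mult_left_mono) (auto simp: dist_real_def)
  have "dist x y \<le> (\<Sum>n. (1/2) ^ n * \<delta>)"
    unfolding dist_fun_def
    by (intro suminf_le le s summable_comparison_test'[OF s, of 0]) (use le in \<open>simp add: 0\<close>)
  also have "\<dots> = 2 * \<delta>"
    by (subst suminf_mult2[symmetric]) (simp_all add: suminf_geometric summable_geometric)
  finally show ?thesis .
qed

lemma continuous_on_box:
  fixes u :: "(nat \<Rightarrow> real) \<Rightarrow> real"
  assumes u: "continuous_on UNIV u"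
  obtains "\<exists>B'. \<forall>x. (\<forall>i. \<bar>x i\<bar> \<le> B) \<longrightarrow> \<bar>u x\<bar> \<le> B'"
    "\<And>\<epsilon>. 0 < \<epsilon> \<Longrightarrow> \<exists>\<delta>>0. \<forall>x y. (\<forall>i. \<bar>x i\<bar> \<le> B) \<longrightarrow> (\<forall>i. \<bar>y i\<bar> \<le> B) \<longrightarrow>
        (\<forall>i. \<bar>x i - y i\<bar> \<le> \<delta>) \<longrightarrow> \<bar>u x - u y\<bar> \<le> \<epsilon>"
proof -
  let ?C = "{x :: nat \<Rightarrow> real. \<forall>i. \<bar>x i\<bar> \<le> B}"
  have uc: "continuous_on ?C u" using u by (rule continuous_on_subset) simp
  have "bounded (u ` ?C)"
    by (intro compact_imp_bounded compact_continuous_image uc compact_box)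
  then have 1: "\<exists>B'. \<forall>x. (\<forall>i. \<bar>x i\<bar> \<le> B) \<longrightarrow> \<bar>u x\<bar> \<le> B'"
    by (auto simp: bounded_iff)
  have un: "uniformly_continuous_on ?C u" by (rule compact_uniformly_continuous[OF uc compact_box])
  have 2: "\<exists>\<delta>>0. \<forall>x y. (\<forall>i. \<bar>x i\<bar> \<le> B) \<longrightarrow> (\<forall>i. \<bar>y i\<bar> \<le> B) \<longrightarrow>
        (\<forall>i. \<bar>x i - y i\<bar> \<le> \<delta>) \<longrightarrow> \<bar>u x - u y\<bar> \<le> \<epsilon>" if "0 < \<epsilon>" for \<epsilon>
  proof -
    obtain d where d: "d > 0" "\<And>x y. x \<in> ?C \<Longrightarrow> y \<in> ?C \<Longrightarrow> dist y x < d \<Longrightarrow> dist (u y) (u x) < \<epsilon>"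
      using uniformly_continuous_onE[OF un \<open>0 < \<epsilon>\<close>] by blast
    \<comment> \<open>With coordinate bound \<open>d/3\<close>, the factor 2 of
      \<open>dist_fun_le\<close> still leaves the distance strictly below \<open>d\<close>.\<close>
    have "\<bar>u x - u y\<bar> \<le> \<epsilon>"
      if "\<forall>i. \<bar>x i\<bar> \<le> B" "\<forall>i. \<bar>y i\<bar> \<le> B" "\<forall>i. \<bar>x i - y i\<bar> \<le> d/3" for x y
    proof -
      have "dist x y \<le> 2 * (d/3)" using that(3) by (intro dist_fun_le) auto
      also have "\<dots> < d" using d(1) by simp
      finally show ?thesis using d(2)[of y x] that(1,2) by (simp add: dist_real_def)
    qed
    then show ?thesis using d(1) by (intro exI[of _ "d/3"]) auto
  qed
  show thesis by (rule that[OF 1 2])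
qed

section \<open>Bounds and moduli of continuity for formulas\<close>

definition cnv_bounded :: "('a, 'm) monoid_scheme \<Rightarrow> cnv_form \<Rightarrow> bool" where
  "cnv_bounded G \<phi> \<longleftrightarrow>
     (\<exists>B. \<forall>v. range v \<subseteq> cnv_ball G \<longrightarrow> \<bar>cnv_val (conv_algebra G) \<phi> v\<bar> \<le> B)"

text \<open>Only the first \<open>N\<close> entries must be close, so that in the end finitely many
  parameters are approximated and their supports fit into one finite tuple.\<close>

definition cnv_close :: "('a, 'm) monoid_scheme \<Rightarrow> cnv_form \<Rightarrow> real \<Rightarrow> real \<Rightarrow> nat \<Rightarrow> bool" where
  "cnv_close G \<phi> \<epsilon> \<delta> N \<longleftrightarrow>
     (\<forall>v w. range v \<subseteq> cnv_ball G \<longrightarrow> range w \<subseteq> cnv_ball G \<longrightarrow>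
       (\<forall>i<N. ell1_dist G (v i) (w i) \<le> \<delta>) \<longrightarrow>
       \<bar>cnv_val (conv_algebra G) \<phi> v - cnv_val (conv_algebra G) \<phi> w\<bar> \<le> \<epsilon>)"

lemma cnv_close_mono: "cnv_close G \<phi> \<epsilon> \<delta> N \<Longrightarrow> \<delta>' \<le> \<delta> \<Longrightarrow> N \<le> N' \<Longrightarrow> cnv_close G \<phi> \<epsilon> \<delta>' N'"
  unfolding cnv_close_def by (meson order_trans less_le_trans)

lemma cnv_close_list:
  assumes "\<And>\<phi>. \<phi> \<in> set \<phi>s \<Longrightarrow> \<exists>\<delta>>0. \<exists>N. cnv_close G \<phi> \<epsilon> \<delta> N"
  shows "\<exists>\<delta>>0. \<exists>N. \<forall>\<phi>\<in>set \<phi>s. cnv_close G \<phi> \<epsilon> \<delta> N"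
  using assms
proof (induction \<phi>s)
  case Nil
  show ?case by (auto intro: exI[of _ 1])
next
  case (Cons \<phi> \<phi>s)
  then obtain \<delta> N where 1: "\<delta> > 0" "\<forall>\<phi>\<in>set \<phi>s. cnv_close G \<phi> \<epsilon> \<delta> N" by auto
  from Cons.prems obtain \<delta>' N' where 2: "\<delta>' > 0" "cnv_close G \<phi> \<epsilon> \<delta>' N'"
    by (meson list.set_intros(1))
  show ?case
    by (rule exI[of _ "min \<delta> \<delta>'"], rule conjI, use 1 2 in simp, rule exI[of _ "max N N'"])
      (use 1 2 in \<open>auto intro: cnv_close_mono\<close>)
qed

lemma fun_upd_ball: "range v \<subseteq> X \<Longrightarrow> a \<in> X \<Longrightarrow> range (v(i := a)) \<subseteq> X"
  by auto

lemma (in group) CDist_bounded_close: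
  "cnv_bounded G (CDist s t) \<and> (\<forall>\<epsilon>>0. \<exists>\<delta>>0. \<exists>N. cnv_close G (CDist s t) \<epsilon> \<delta> N)"
proof -
  obtain N K where L: "cnv_Lipschitz G s N K" using cnv_term_val_Lipschitz by blast
  obtain N' K' where L': "cnv_Lipschitz G t N' K'" using cnv_term_val_Lipschitz by blast
  have K: "0 \<le> K" "0 \<le> K'" using L L' by (auto simp: cnv_Lipschitz_def)
  have "\<bar>cnv_val (conv_algebra G) (CDist s t) v\<bar> \<le> 2" if "range v \<subseteq> cnv_ball G" for v
  proof -
    let ?f = "cnv_term_val (conv_algebra G) s v" and ?g = "cnv_term_val (conv_algebra G) t v"
    have fg: "?f \<in> ell1 G" "?g \<in> ell1 G" "ell1_norm G ?f \<le> 1" "ell1_norm G ?g \<le> 1"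
      using cnv_term_val_ball[OF that] by (simp_all add: cnv_ball_iff)
    have "ell1_dist G ?f ?g \<le> 1 * (ell1_norm G ?f + ell1_norm G ?g)"
      by (rule ell1_dominated(2)[OF fg(1,2)]) (simp_all add: abs_triangle_ineq4)
    then show ?thesis using fg(3,4) ell1_norm_nonneg[of G "\<lambda>x. ?f x - ?g x"] by simp
  qed
  moreover have "\<exists>\<delta>>0. \<exists>N. cnv_close G (CDist s t) \<epsilon> \<delta> N" if "\<epsilon> > 0" for \<epsilon>
  proof -
    \<comment> \<open>The summand 1 keeps the denominator positive when both Lipschitz constants are
      0.\<close>
    define \<delta> where "\<delta> = \<epsilon> / (K + K' + 1)"
    have \<delta>: "\<delta> > 0" "(K + K') * \<delta> \<le> \<epsilon>"
      using K that by (auto simp: \<delta>_def field_simps add_nonneg_pos)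
    have "cnv_close G (CDist s t) \<epsilon> \<delta> (max N N')"
      unfolding cnv_close_def
    proof (intro allI impI)
      fix v w assume v: "range v \<subseteq> cnv_ball G" and w: "range w \<subseteq> cnv_ball G"
        and d: "\<forall>i<max N N'. ell1_dist G (v i) (w i) \<le> \<delta>"
      let ?T = "cnv_term_val (conv_algebra G)"
      have e: "?T s v \<in> ell1 G" "?T t v \<in> ell1 G" "?T s w \<in> ell1 G" "?T t w \<in> ell1 G"
        using cnv_term_val_ball[OF v] cnv_term_val_ball[OF w] by (auto simp: cnv_ball_iff)
      have "ell1_dist G (?T s v) (?T s w) \<le> K * \<delta>" "ell1_dist G (?T t v) (?T t w) \<le> K' * \<delta>"
        using cnv_LipschitzD[OF L v w] cnv_LipschitzD[OF L' v w] \<delta>(1) d by auto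
      moreover have
        "ell1_dist G (?T s v) (?T t v) \<le> ell1_dist G (?T s v) (?T s w) + ell1_dist G (?T s w) (?T t v)"
        "ell1_dist G (?T s w) (?T t v) \<le> ell1_dist G (?T s w) (?T t w) + ell1_dist G (?T t w) (?T t v)"
        "ell1_dist G (?T s w) (?T t w) \<le> ell1_dist G (?T s w) (?T s v) + ell1_dist G (?T s v) (?T t w)"
        "ell1_dist G (?T s v) (?T t w) \<le> ell1_dist G (?T s v) (?T t v) + ell1_dist G (?T t v) (?T t w)"
        by (intro ell1_dist_triangle e)+
      ultimately show "\<bar>cnv_val (conv_algebra G) (CDist s t) v - cnv_val (conv_algebra G) (CDist s t) w\<bar> \<le> \<epsilon>"
        using \<delta>(2) ell1_dist_commute[of G "?T s v" "?T s w"] ell1_dist_commute[of G "?T t v" "?T t w"]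
        by (simp add: distrib_right)
    qed
    then show ?thesis using \<delta>(1) by blast
  qed
  ultimately show ?thesis unfolding cnv_bounded_def by blast
qed

lemma quantifier_bounded_close:
  assumes b: "cnv_bounded G \<phi>" and c: "\<And>\<epsilon>. 0 < \<epsilon> \<Longrightarrow> \<exists>\<delta>>0. \<exists>N. cnv_close G \<phi> \<epsilon> \<delta> N"
    and Q: "Q = CSup \<or> Q = CInf"
  shows "cnv_bounded G (Q j \<phi>) \<and> (\<forall>\<epsilon>>0. \<exists>\<delta>>0. \<exists>N. cnv_close G (Q j \<phi>) \<epsilon> \<delta> N)"
proof -
  let ?V = "cnv_val (conv_algebra G) \<phi>"
  have ne: "cnv_ball G \<noteq> {}" using zero_in_cnv_ball by blast
  obtain B where B: "\<And>v. range v \<subseteq> cnv_ball G \<Longrightarrow> \<bar>?V v\<bar> \<le> B"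
    using b unfolding cnv_bounded_def by blast
  have B0: "0 \<le> B"
    using B[of "\<lambda>i x. 0"] zero_in_cnv_ball abs_ge_zero order_trans by (metis image_subsetI)
  have "\<bar>cnv_val (conv_algebra G) (Q j \<phi>) v\<bar> \<le> B" if v: "range v \<subseteq> cnv_ball G" for v
  proof -
    have Vb: "\<bar>?V (v(j := a))\<bar> \<le> B" if "a \<in> cnv_ball G" for a
      by (rule B[OF fun_upd_ball[OF v that]])
    \<comment> \<open>Boundedness is read as closeness to the constant 0, so
      \<open>SUP_INF_close\<close> serves here too.\<close>
    have "\<bar>(SUP a\<in>cnv_ball G. ?V (v(j := a))) - (SUP a\<in>cnv_ball G. 0)\<bar> \<le> B"
      "\<bar>(INF a\<in>cnv_ball G. ?V (v(j := a))) - (INF a\<in>cnv_ball G. 0)\<bar> \<le> B"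
      by (rule SUP_INF_close[OF ne ne Vb, where L = 0]; use Vb in auto)+
    then show ?thesis using Q ne by auto
  qed
  moreover have "\<exists>\<delta>>0. \<exists>N. cnv_close G (Q j \<phi>) \<epsilon> \<delta> N" if \<epsilon>: "\<epsilon> > 0" for \<epsilon>
  proof -
    obtain \<delta> N where \<delta>: "\<delta> > 0" "cnv_close G \<phi> \<epsilon> \<delta> N" using c[OF \<epsilon>] by blast
    have "cnv_close G (Q j \<phi>) \<epsilon> \<delta> N"
      unfolding cnv_close_def
    proof (intro allI impI)
      fix v w assume v: "range v \<subseteq> cnv_ball G" and w: "range w \<subseteq> cnv_ball G"
        and d: "\<forall>i<N. ell1_dist G (v i) (w i) \<le> \<delta>"
      have close: "\<bar>?V (v(j := a)) - ?V (w(j := a))\<bar> \<le> \<epsilon>" if a: "a \<in> cnv_ball G" for a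
      proof -
        \<comment> \<open>The same \<open>a\<close> enters on both sides, so entry \<open>j\<close>
          has distance 0 and the modulus of \<phi> is kept unchanged.\<close>
        have "\<forall>i<N. ell1_dist G ((v(j := a)) i) ((w(j := a)) i) \<le> \<delta>"
          using d \<delta>(1) by (simp add: ell1_norm_def)
        then show ?thesis
          using \<delta>(2) fun_upd_ball[OF v a] fun_upd_ball[OF w a] unfolding cnv_close_def by blast
      qed
      then have close': "\<exists>b\<in>cnv_ball G. \<bar>?V (v(j := a)) - ?V (w(j := b))\<bar> \<le> \<epsilon>"
          "\<exists>b\<in>cnv_ball G. \<bar>?V (v(j := b)) - ?V (w(j := a))\<bar> \<le> \<epsilon>"
        if "a \<in> cnv_ball G" for a
        using that by blast+
      show "\<bar>cnv_val (conv_algebra G) (Q j \<phi>) v - cnv_val (conv_algebra G) (Q j \<phi>) w\<bar> \<le> \<epsilon>"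
        using Q SUP_INF_close[where f = "\<lambda>a. ?V (v(j := a))" and g = "\<lambda>a. ?V (w(j := a))",
            OF ne ne B[OF fun_upd_ball[OF v]] B[OF fun_upd_ball[OF w]] close']
        by auto
    qed
    then show ?thesis using \<delta>(1) by blast
  qed
  ultimately show ?thesis unfolding cnv_bounded_def by blast
qed

lemma (in group) cnv_val_bounded_close:
  assumes "cnv_wf \<phi>"
  shows "cnv_bounded G \<phi> \<and> (\<forall>\<epsilon>>0. \<exists>\<delta>>0. \<exists>N. cnv_close G \<phi> \<epsilon> \<delta> N)"
  using assms
proof (induction \<phi>)
  case (CDist s t)
  show ?case by (rule CDist_bounded_close)
next
  case (CNorm t)
  \<comment> \<open>The norm is the distance to the value of \<open>CZero\<close>.\<close>
  show ?case
    using CDist_bounded_close[of t CZero] by (simp add: cnv_bounded_def cnv_close_def)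
next
  case (CConn u \<phi>s)
  let ?x = "\<lambda>v i. if i < length \<phi>s then map (\<lambda>\<phi>. cnv_val (conv_algebra G) \<phi> v) \<phi>s ! i else 0"
  have u: "continuous_on UNIV u" and IH: "\<And>\<phi>. \<phi> \<in> set \<phi>s \<Longrightarrow>
      cnv_bounded G \<phi> \<and> (\<forall>\<epsilon>>0. \<exists>\<delta>>0. \<exists>N. cnv_close G \<phi> \<epsilon> \<delta> N)"
    using CConn by auto
  have "\<exists>B. \<forall>\<phi>\<in>set \<phi>s. \<forall>v. range v \<subseteq> cnv_ball G \<longrightarrow> \<bar>cnv_val (conv_algebra G) \<phi> v\<bar> \<le> B"
  proof -
    obtain b where b: "\<And>\<phi> v. \<phi> \<in> set \<phi>s \<Longrightarrow> range v \<subseteq> cnv_ball G \<Longrightarrow> \<bar>cnv_val (conv_algebra G) \<phi> v\<bar> \<le> b \<phi>"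
      using IH unfolding cnv_bounded_def by metis
    have "b \<phi> \<le> Max (b ` set \<phi>s)" if "\<phi> \<in> set \<phi>s" for \<phi> using that by simp
    then show ?thesis using b by (meson order_trans)
  qed
  then obtain B0 where B0: "\<And>\<phi> v. \<phi> \<in> set \<phi>s \<Longrightarrow> range v \<subseteq> cnv_ball G \<Longrightarrow>
      \<bar>cnv_val (conv_algebra G) \<phi> v\<bar> \<le> B0" by blast
  \<comment> \<open>The maximum with 0 puts the zeros that pad the arguments into the box, also when
    \<open>B0\<close> is negative, as can happen for an empty list.\<close>
  define B where "B = max 0 B0"
  have x: "\<forall>i. \<bar>?x v i\<bar> \<le> B" if "range v \<subseteq> cnv_ball G" for v
    using B0[OF _ that] by (auto simp: B_def le_max_iff_disj)
  obtain B' where B': "\<And>x. (\<forall>i. \<bar>x i\<bar> \<le> B) \<Longrightarrow> \<bar>u x\<bar> \<le> B'"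
    using continuous_on_box[OF u, of B] by metis
  have "cnv_bounded G (CConn u \<phi>s)"
    unfolding cnv_bounded_def using B'[OF x] by auto
  moreover have "\<exists>\<delta>>0. \<exists>N. cnv_close G (CConn u \<phi>s) \<epsilon> \<delta> N" if "\<epsilon> > 0" for \<epsilon>
  proof -
    obtain \<eta> where \<eta>: "\<eta> > 0" "\<And>x y. (\<forall>i. \<bar>x i\<bar> \<le> B) \<Longrightarrow> (\<forall>i. \<bar>y i\<bar> \<le> B) \<Longrightarrow>
        (\<forall>i. \<bar>x i - y i\<bar> \<le> \<eta>) \<Longrightarrow> \<bar>u x - u y\<bar> \<le> \<epsilon>"
      using continuous_on_box[OF u, of B] \<open>\<epsilon> > 0\<close> by metis
    obtain \<delta> N where \<delta>: "\<delta> > 0" "\<forall>\<phi>\<in>set \<phi>s. cnv_close G \<phi> \<eta> \<delta> N"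
      using cnv_close_list[of \<phi>s G \<eta>] IH \<eta>(1) by blast
    have "cnv_close G (CConn u \<phi>s) \<epsilon> \<delta> N"
      unfolding cnv_close_def
    proof (intro allI impI)
      fix v w assume v: "range v \<subseteq> cnv_ball G" and w: "range w \<subseteq> cnv_ball G"
        and d: "\<forall>i<N. ell1_dist G (v i) (w i) \<le> \<delta>"
      have "\<forall>i. \<bar>?x v i - ?x w i\<bar> \<le> \<eta>"
        using \<delta>(2) v w d \<eta>(1) by (simp add: cnv_close_def)
      then have "\<bar>u (?x v) - u (?x w)\<bar> \<le> \<epsilon>" by (intro \<eta>(2) x v w)
      then show "\<bar>cnv_val (conv_algebra G) (CConn u \<phi>s) v - cnv_val (conv_algebra G) (CConn u \<phi>s) w\<bar> \<le> \<epsilon>"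
        by simp
    qed
    then show ?thesis using \<delta>(1) by blast
  qed
  ultimately show ?case by blast
next
  case (CSup j \<phi>)
  then show ?case using quantifier_bounded_close[of G \<phi> CSup] by simp
next
  case (CInf j \<phi>)
  then show ?case using quantifier_bounded_close[of G \<phi> CInf] by simp
qed

section \<open>Back and forth\<close>

text \<open>This expresses \<open>corr\<close> for the induced isomorphism through words instead of
  \<open>word_map\<close>, which makes it visibly symmetric and easy to follow when the tuples
  grow.\<close>

definition word_corr ::
    "('a, 'm) monoid_scheme \<Rightarrow> ('a, 'n) monoid_scheme \<Rightarrow> nat \<Rightarrow> (nat \<Rightarrow> 'a) \<Rightarrow> (nat \<Rightarrow> 'a) \<Rightarrow>
      ('a \<Rightarrow> real) \<Rightarrow> ('a \<Rightarrow> real) \<Rightarrow> bool" where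
  "word_corr G H k a b f g \<longleftrightarrow>
     (\<forall>x. x \<notin> word_vals G k a \<longrightarrow> f x = 0) \<and> (\<forall>y. y \<notin> word_vals H k b \<longrightarrow> g y = 0) \<and>
     (\<forall>t\<in>grp_words k. g (grp_term_val H t b) = f (grp_term_val G t a))"

lemma word_corr_sym: "word_corr G H k a b f g \<Longrightarrow> word_corr H G k b a g f"
  by (simp add: word_corr_def)

lemma word_corr_imp_corr:
  assumes "group G" "group H" "same_type G H k a b" "word_corr G H k a b f g"
  shows "subsemigroup_iso.corr (word_vals G k a) (word_vals H k b) (word_map G H k a b) f g"
proof -
  interpret subsemigroup_iso G H "word_vals G k a" "word_vals H k b" "word_map G H k a b"
    by (rule same_type_imp_iso[OF assms(1-3)])
  have "g (word_map G H k a b x) = f x" if "x \<in> word_vals G k a" for x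
    using that assms(4) word_map_val[OF assms(3)] by (auto simp: word_corr_def word_vals_def)
  then show ?thesis using assms(4) by (simp add: corr_def word_corr_def)
qed

text \<open>A new word either agrees with an old one, and then does so in both groups by the longer
  type, or has its value outside the old semigroups on both sides, where \<open>f\<close> and
  \<open>g\<close> vanish.\<close>

lemma word_corr_extend:
  assumes corr: "word_corr G H k a b f g" and st: "same_type G H k' a' b'" and "k \<le> k'"
    and "\<And>i. i < k \<Longrightarrow> a' i = a i" "\<And>i. i < k \<Longrightarrow> b' i = b i"
  shows "word_corr G H k' a' b' f g"
proof -
  have words: "grp_words k \<subseteq> grp_words k'" by (rule grp_words_mono) fact
  have va: "grp_term_val G s a' = grp_term_val G s a" and vb: "grp_term_val H s b' = grp_term_val H s b"
    if "s \<in> grp_words k" for s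
    using word_val_cong[OF that] assms(4,5) by blast+
  have sub: "word_vals G k a \<subseteq> word_vals G k' a'" "word_vals H k b \<subseteq> word_vals H k' b'"
    using words va vb by (force simp: word_vals_def)+
  have "g (grp_term_val H t b') = f (grp_term_val G t a')" if t: "t \<in> grp_words k'" for t
  proof (cases "\<exists>s\<in>grp_words k. grp_term_val G t a' = grp_term_val G s a'")
    case True
    then obtain s where s: "s \<in> grp_words k" "grp_term_val G t a' = grp_term_val G s a'" by blast
    then have "grp_term_val H t b' = grp_term_val H s b'"
      using same_type_word_eq_iff[OF st t] words by blast
    then show ?thesis
      using s corr va vb by (simp add: word_corr_def)
  next
    case False
    then have "grp_term_val H t b' \<noteq> grp_term_val H s b'" if "s \<in> grp_words k" for s
      using that same_type_word_eq_iff[OF st t] words by blast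
    then have "grp_term_val G t a' \<notin> word_vals G k a" "grp_term_val H t b' \<notin> word_vals H k b"
      using False va vb by (auto simp: word_vals_def)
    then show ?thesis using corr by (simp add: word_corr_def)
  qed
  then show ?thesis using corr sub by (auto simp: word_corr_def)
qed

text \<open>The function is pulled back along the word map in the reverse direction and extended by
  zero.\<close>

lemma word_corr_exists:
  assumes "same_type G H k a b" "\<And>x. x \<notin> word_vals G k a \<Longrightarrow> f x = 0"
  obtains g where "word_corr G H k a b f g"
proof
  show "word_corr G H k a b f
      (\<lambda>y. if y \<in> word_vals H k b then f (word_map H G k b a y) else 0)"
    using assms(2) word_map_val[OF same_type_sym[OF assms(1)]]
    by (auto simp: word_corr_def word_vals_def)
qed

lemma generators_in_word_vals: "a ` {..<k} \<subseteq> word_vals G k a"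
proof
  fix x assume "x \<in> a ` {..<k}"
  then obtain i where "i < k" "x = a i" by auto
  then have "GVar i \<in> grp_words k" "x = grp_term_val G (GVar i) a" by (auto simp: grp_words_def)
  then show "x \<in> word_vals G k a" unfolding word_vals_def by blast
qed

text \<open>All lengths \<open>k\<close> and all tuples are quantified inside, so that the induction
  hypothesis applies to the longer tuples made at a quantifier.\<close>

definition transfers :: "('a, 'm) monoid_scheme \<Rightarrow> ('a, 'n) monoid_scheme \<Rightarrow> cnv_form \<Rightarrow> bool" where
  "transfers G H \<phi> \<longleftrightarrow> (\<forall>k a b v w. same_type G H k a b \<longrightarrow> (\<forall>i. word_corr G H k a b (v i) (w i)) \<longrightarrow>
     range v \<subseteq> cnv_ball G \<longrightarrow> range w \<subseteq> cnv_ball H \<longrightarrow>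
     cnv_val (conv_algebra G) \<phi> v = cnv_val (conv_algebra H) \<phi> w)"

lemma transfersD:
  assumes "transfers G H \<phi>" "same_type G H k a b" "\<And>i. word_corr G H k a b (v i) (w i)"
    "range v \<subseteq> cnv_ball G" "range w \<subseteq> cnv_ball H"
  shows "cnv_val (conv_algebra G) \<phi> v = cnv_val (conv_algebra H) \<phi> w"
  using assms unfolding transfers_def by blast

lemma transfers_sym: "transfers G H \<phi> \<Longrightarrow> transfers H G \<phi>"
  unfolding transfers_def by (metis same_type_sym word_corr_sym)

lemma transfers_forth:
  assumes grp: "group G" "group H" and sat: "grp_omega_saturated H" and wf: "cnv_wf \<phi>"
    and tr: "transfers G H \<phi>" and st: "same_type G H k a b"
    and corr: "\<And>i. word_corr G H k a b (v i) (w i)"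
    and v: "range v \<subseteq> cnv_ball G" and w: "range w \<subseteq> cnv_ball H"
    and f: "f \<in> cnv_ball G" and \<epsilon>: "0 < \<epsilon>"
  shows "\<exists>g\<in>cnv_ball H.
    \<bar>cnv_val (conv_algebra G) \<phi> (v(j := f)) - cnv_val (conv_algebra H) \<phi> (w(j := g))\<bar> \<le> \<epsilon>"
proof -
  \<comment> \<open>Uniform continuity is invoked only in G: the function \<open>g\<close> below is
    an exact transport of the truncation \<open>f'\<close>, so passing to H costs nothing.\<close>
  obtain \<delta> N where \<delta>: "\<delta> > 0" "cnv_close G \<phi> \<epsilon> \<delta> N"
    using group.cnv_val_bounded_close[OF grp(1) wf] \<epsilon> by blast
  obtain F f' where F: "finite F" "F \<subseteq> carrier G" "f' \<in> cnv_ball G" "\<And>x. x \<notin> F \<Longrightarrow> f' x = 0"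
    "ell1_dist G f f' \<le> \<delta>"
    using finite_support_dense[OF f \<delta>(1)] by blast
  obtain k' a' b' where ext: "k \<le> k'" "same_type G H k' a' b'"
    "\<And>i. i < k \<Longrightarrow> a' i = a i" "\<And>i. i < k \<Longrightarrow> b' i = b i" "F \<subseteq> a' ` {..<k'}"
    using same_type_extend[OF st sat F(1,2)] by metis
  have "f' x = 0" if "x \<notin> word_vals G k' a'" for x
    using that F(4) ext(5) generators_in_word_vals[of a' k' G] by blast
  then obtain g where g: "word_corr G H k' a' b' f' g"
    using word_corr_exists[OF ext(2)] by metis
  have gb: "g \<in> cnv_ball H"
    using subsemigroup_iso.corr_ball[OF same_type_imp_iso[OF grp ext(2)]
        word_corr_imp_corr[OF grp ext(2) g]] F(3) by simp
  have "word_corr G H k' a' b' ((v(j := f')) i) ((w(j := g)) i)" for i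
    using g word_corr_extend[OF corr ext(2,1,3,4)] by auto
  then have "cnv_val (conv_algebra G) \<phi> (v(j := f')) = cnv_val (conv_algebra H) \<phi> (w(j := g))"
    by (rule transfersD[OF tr ext(2)]) (use v w F(3) gb in auto)
  moreover have "\<forall>i<N. ell1_dist G ((v(j := f)) i) ((v(j := f')) i) \<le> \<delta>"
    using F(5) \<delta>(1) by (simp add: ell1_norm_def)
  then have "\<bar>cnv_val (conv_algebra G) \<phi> (v(j := f)) - cnv_val (conv_algebra G) \<phi> (v(j := f'))\<bar> \<le> \<epsilon>"
    using \<delta>(2) fun_upd_ball[OF v f] fun_upd_ball[OF v F(3)] unfolding cnv_close_def by blast
  ultimately show ?thesis using gb by auto
qed

text \<open>Going forth uses saturation of H, going back is the same lemma with the groups exchanged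
  and uses saturation of G. The two values then differ by at most every positive \<epsilon>.\<close>

lemma transfers_quantifier:
  fixes G :: "('a, 'm) monoid_scheme" and H :: "('a, 'n) monoid_scheme"
  assumes grp: "group G" "group H" and sat: "grp_omega_saturated G" "grp_omega_saturated H"
    and wf: "cnv_wf \<phi>" and tr: "transfers G H \<phi>" and Q: "Q = CSup \<or> Q = CInf"
  shows "transfers G H (Q j \<phi>)"
  unfolding transfers_def
proof (intro allI impI)
  fix k a b and v w :: "nat \<Rightarrow> 'a \<Rightarrow> real"
  assume st: "same_type G H k a b" and "\<forall>i. word_corr G H k a b (v i) (w i)"
    and v: "range v \<subseteq> cnv_ball G" and w: "range w \<subseteq> cnv_ball H"
  then have corr: "word_corr G H k a b (v i) (w i)" for i by blast
  obtain B where B: "\<And>v. range v \<subseteq> cnv_ball G \<Longrightarrow> \<bar>cnv_val (conv_algebra G) \<phi> v\<bar> \<le> B"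
    using group.cnv_val_bounded_close[OF grp(1) wf] unfolding cnv_bounded_def by blast
  obtain B' where B': "\<And>v. range v \<subseteq> cnv_ball H \<Longrightarrow> \<bar>cnv_val (conv_algebra H) \<phi> v\<bar> \<le> B'"
    using group.cnv_val_bounded_close[OF grp(2) wf] unfolding cnv_bounded_def by blast
  have ne: "cnv_ball G \<noteq> {}" "cnv_ball H \<noteq> {}" using zero_in_cnv_ball by blast+
  have "\<bar>cnv_val (conv_algebra G) (Q j \<phi>) v - cnv_val (conv_algebra H) (Q j \<phi>) w\<bar> \<le> \<epsilon>"
    if \<epsilon>: "0 < \<epsilon>" for \<epsilon>
  proof -
    note close = SUP_INF_close[where f = "\<lambda>a. cnv_val (conv_algebra G) \<phi> (v(j := a))"
        and g = "\<lambda>a. cnv_val (conv_algebra H) \<phi> (w(j := a))",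
        OF ne B[OF fun_upd_ball[OF v]] B'[OF fun_upd_ball[OF w]]]
    note forward = transfers_forth[OF grp sat(2) wf tr st corr v w _ \<epsilon>]
    note backward = transfers_forth[OF grp(2,1) sat(1) wf transfers_sym[OF tr] same_type_sym[OF st]
        word_corr_sym[OF corr] w v _ \<epsilon>]
    have backward': "\<exists>f\<in>cnv_ball G.
        \<bar>cnv_val (conv_algebra G) \<phi> (v(j := f)) - cnv_val (conv_algebra H) \<phi> (w(j := g))\<bar> \<le> \<epsilon>"
      if "g \<in> cnv_ball H" for g
      using backward[OF that, of j] by (simp add: abs_minus_commute)
    show ?thesis using Q close[OF _ _ forward backward'] by auto
  qed
  then have "\<bar>cnv_val (conv_algebra G) (Q j \<phi>) v - cnv_val (conv_algebra H) (Q j \<phi>) w\<bar> \<le> 0"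
    by (rule field_le_epsilon[where y = 0, simplified])
  then show "cnv_val (conv_algebra G) (Q j \<phi>) v = cnv_val (conv_algebra H) (Q j \<phi>) w" by simp
qed

lemma saturated_transfers:
  fixes G :: "('a, 'm) monoid_scheme" and H :: "('a, 'n) monoid_scheme"
  assumes grp: "group G" "group H" and sat: "grp_omega_saturated G" "grp_omega_saturated H"
    and wf: "cnv_wf \<phi>"
  shows "transfers G H \<phi>"
  using wf
proof (induction \<phi>)
  case (CDist s t)
  show ?case unfolding transfers_def
  proof (intro allI impI)
    fix k a b and v w :: "nat \<Rightarrow> 'a \<Rightarrow> real"
    assume st: "same_type G H k a b" and "\<forall>i. word_corr G H k a b (v i) (w i)"
    then interpret subsemigroup_iso G H "word_vals G k a" "word_vals H k b" "word_map G H k a b"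
      using same_type_imp_iso[OF grp] by blast
    have "corr (v i) (w i)" for i
      using \<open>\<forall>i. word_corr G H k a b (v i) (w i)\<close> word_corr_imp_corr[OF grp st] by blast
    then show "cnv_val (conv_algebra G) (CDist s t) v = cnv_val (conv_algebra H) (CDist s t) w"
      using corr_dist[OF corr_term_val corr_term_val] by simp
  qed
next
  case (CNorm t)
  show ?case unfolding transfers_def
  proof (intro allI impI)
    fix k a b and v w :: "nat \<Rightarrow> 'a \<Rightarrow> real"
    assume st: "same_type G H k a b" and "\<forall>i. word_corr G H k a b (v i) (w i)"
    then interpret subsemigroup_iso G H "word_vals G k a" "word_vals H k b" "word_map G H k a b"
      using same_type_imp_iso[OF grp] by blast
    have "corr (v i) (w i)" for i
      using \<open>\<forall>i. word_corr G H k a b (v i) (w i)\<close> word_corr_imp_corr[OF grp st] by blast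
    then show "cnv_val (conv_algebra G) (CNorm t) v = cnv_val (conv_algebra H) (CNorm t) w"
      using corr_norm[OF corr_term_val] by simp
  qed
next
  case (CConn u \<phi>s)
  then have IH: "\<And>\<phi>. \<phi> \<in> set \<phi>s \<Longrightarrow> transfers G H \<phi>" by simp
  show ?case unfolding transfers_def
  proof (intro allI impI)
    fix k a b and v w :: "nat \<Rightarrow> 'a \<Rightarrow> real"
    assume *: "same_type G H k a b" "\<forall>i. word_corr G H k a b (v i) (w i)"
      "range v \<subseteq> cnv_ball G" "range w \<subseteq> cnv_ball H"
    have "map (\<lambda>\<phi>. cnv_val (conv_algebra G) \<phi> v) \<phi>s = map (\<lambda>\<phi>. cnv_val (conv_algebra H) \<phi> w) \<phi>s"
      using IH * by (intro map_cong refl transfersD) auto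
    then show "cnv_val (conv_algebra G) (CConn u \<phi>s) v = cnv_val (conv_algebra H) (CConn u \<phi>s) w"
      by (simp only: cnv_val.simps)
  qed
next
  case (CSup j \<phi>)
  then show ?case using transfers_quantifier[OF grp sat, of \<phi> CSup] by simp
next
  case (CInf j \<phi>)
  then show ?case using transfers_quantifier[OF grp sat, of \<phi> CInf] by simp
qed

section \<open>Passage from tuples to the elementary substructure\<close>

lemma elementary_substructureD:
  assumes "grp_elementary_substructure G H"
  shows "carrier G \<subseteq> carrier H"
    and "x \<in> carrier G \<Longrightarrow> y \<in> carrier G \<Longrightarrow> x \<otimes>\<^bsub>H\<^esub> y = x \<otimes>\<^bsub>G\<^esub> y"
    and "range a \<subseteq> carrier G \<Longrightarrow> grp_params \<phi> = {} \<Longrightarrow> grp_sat G \<phi> a \<longleftrightarrow> grp_sat H \<phi> a"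
  using assms by (simp_all add: grp_elementary_substructure_def)

lemma elementary_same_type:
  assumes "grp_elementary_substructure G H" "range a \<subseteq> carrier G"
  shows "same_type G H k a a"
proof -
  have "grp_sat G \<phi> a \<longleftrightarrow> grp_sat H \<phi> a" if "\<phi> \<in> grp_formulas_over {} k" for \<phi>
    using that by (intro elementary_substructureD(3)[OF assms]) (simp add: grp_formulas_over_def)
  moreover have "range a \<subseteq> carrier H" using elementary_substructureD(1)[OF assms(1)] assms(2) by blast
  ultimately show ?thesis using assms(2) unfolding same_type_def by blast
qed

lemma elementary_word_val_eq:
  assumes "group G" "grp_elementary_substructure G H" "range a \<subseteq> carrier G" "t \<in> grp_words k"
  shows "grp_term_val H t a = grp_term_val G t a"
proof -
  interpret group G by fact
  have "grp_term_params t = {} \<Longrightarrow>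
      grp_term_val G t a \<in> carrier G \<and> grp_term_val H t a = grp_term_val G t a"
    using assms(3) by (induction t) (auto simp: elementary_substructureD(2)[OF assms(2)])
  then show ?thesis using assms(4) by (simp add: grp_words_def)
qed

lemma elementary_word_corr_refl:
  assumes "group G" "grp_elementary_substructure G H" "range a \<subseteq> carrier G"
    and "\<And>x. x \<notin> a ` {..<k} \<Longrightarrow> f x = 0"
  shows "word_corr G H k a a f f"
proof -
  have "f x = 0" if "x \<notin> word_vals G k a \<or> x \<notin> word_vals H k a" for x
    using that assms(4)[of x] generators_in_word_vals[of a k G] generators_in_word_vals[of a k H]
    by blast
  then show ?thesis
    using elementary_word_val_eq[OF assms(1-3)] by (simp add: word_corr_def)
qed

text \<open>For this inclusion \<open>corr f f\<close> says that \<open>f\<close> vanishes off the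
  carrier of G, so the transport lemmas yield the substructure property of extension by
  zero.\<close>

lemma elementary_carrier_iso:
  assumes "group G" "group H" "grp_elementary_substructure G H"
  shows "subsemigroup_iso G H (carrier G) (carrier G) (\<lambda>x. x)"
proof -
  interpret G: group G by fact
  interpret H: group H by fact
  show ?thesis
    using elementary_substructureD(1,2)[OF assms(3)]
    by unfold_locales (simp_all add: bij_betw_def)
qed

theorem proposition3p21:
  fixes G :: "('a, 'm) monoid_scheme" and H :: "('a, 'n) monoid_scheme"
  assumes "group G" and "group H"
    and "grp_omega_saturated G" and "grp_omega_saturated H"
    and "grp_elementary_substructure G H"
  shows "cnv_elementary_substructure (conv_algebra G) (conv_algebra H)"
proof -
  interpret subsemigroup_iso G H "carrier G" "carrier G" "\<lambda>x. x"
    by (rule elementary_carrier_iso[OF assms(1,2,5)])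
  have refl: "corr f f" if "f \<in> cnv_ball G" for f
    using that by (auto simp: corr_def cnv_ball_iff ell1_def)
  have sub: "cnv_ball G \<subseteq> cnv_ball H" using corr_ball refl by blast
  have conv: "convolution G f g = convolution H f g" if "f \<in> cnv_ball G" "g \<in> cnv_ball G" for f g
  proof
    fix x
    show "convolution G f g x = convolution H f g x"
      using corr_convolution[OF refl refl, OF that] unfolding corr_def by (cases "x \<in> carrier G") auto
  qed
  have "cnv_substructure (conv_algebra G) (conv_algebra H)"
    using sub conv refl corr_norm corr_dist by (simp add: cnv_substructure_def)
  moreover have "cnv_val (conv_algebra G) \<phi> v = cnv_val (conv_algebra H) \<phi> v"
    if wf: "cnv_wf \<phi>" and v: "range v \<subseteq> cnv_ball G" for \<phi> v
  proof -
    have vH: "range v \<subseteq> cnv_ball H" using v sub by blast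
    have "\<bar>cnv_val (conv_algebra G) \<phi> v - cnv_val (conv_algebra H) \<phi> v\<bar> \<le> \<epsilon>" if "0 < \<epsilon>" for \<epsilon>
    proof -
      obtain \<delta>1 N1 where 1: "\<delta>1 > 0" "cnv_close G \<phi> (\<epsilon>/2) \<delta>1 N1"
        using group.cnv_val_bounded_close[OF assms(1) wf] \<open>0 < \<epsilon>\<close> half_gt_zero by blast
      obtain \<delta>2 N2 where 2: "\<delta>2 > 0" "cnv_close H \<phi> (\<epsilon>/2) \<delta>2 N2"
        using group.cnv_val_bounded_close[OF assms(2) wf] \<open>0 < \<epsilon>\<close> half_gt_zero by blast
      define \<delta> where "\<delta> = min \<delta>1 \<delta>2"
      define N where "N = max N1 N2"
      have \<delta>: "\<delta> > 0" "cnv_close G \<phi> (\<epsilon>/2) \<delta> N" "cnv_close H \<phi> (\<epsilon>/2) \<delta> N"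
        using 1 2 by (auto simp: \<delta>_def N_def intro: cnv_close_mono)
      have "\<exists>F f'. finite F \<and> F \<subseteq> carrier G \<and> f' \<in> cnv_ball G \<and> (\<forall>x. x \<notin> F \<longrightarrow> f' x = 0) \<and>
          ell1_dist G (v i) f' \<le> \<delta>" for i
      proof -
        have "v i \<in> cnv_ball G" using v by blast
        then show ?thesis by (rule finite_support_dense[OF _ \<delta>(1)])
      qed
      then obtain F f' where "\<forall>i. finite (F i) \<and> F i \<subseteq> carrier G \<and> f' i \<in> cnv_ball G \<and>
          (\<forall>x. x \<notin> F i \<longrightarrow> f' i x = 0) \<and> ell1_dist G (v i) (f' i) \<le> \<delta>"
        by metis
      then have F: "\<And>i. finite (F i)" "\<And>i. F i \<subseteq> carrier G" "\<And>i. f' i \<in> cnv_ball G"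
        "\<And>i x. x \<notin> F i \<Longrightarrow> f' i x = 0" "\<And>i. ell1_dist G (v i) (f' i) \<le> \<delta>"
        by blast+
      \<comment> \<open>Entries from \<open>N\<close> on are irrelevant for closeness; setting them
        to zero makes the union of all supports finite.\<close>
      define v' where "v' = (\<lambda>i. if i < N then f' i else (\<lambda>x. 0))"
      have v': "range v' \<subseteq> cnv_ball G" using F(3) zero_in_cnv_ball by (auto simp: v'_def)
      then have v'H: "range v' \<subseteq> cnv_ball H" using sub by blast
      have dG: "\<forall>i<N. ell1_dist G (v i) (v' i) \<le> \<delta>" using F(5) by (simp add: v'_def)
      have dH: "\<forall>i<N. ell1_dist H (v i) (v' i) \<le> \<delta>"
        using dG corr_dist[OF refl refl] v v' by (simp add: range_subsetD)
      have "finite (\<Union>i<N. F i)" using F(1) by auto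
      then obtain xs where xs: "set xs = (\<Union>i<N. F i)" using finite_list by blast
      define k where "k = length xs"
      \<comment> \<open>The tuple enumerates the union of the supports; the unit only fills the
        tail, so that the whole range lies in G.\<close>
      define a where "a = (\<lambda>i. if i < k then xs ! i else \<one>\<^bsub>G\<^esub>)"
      have im: "a ` {..<k} = (\<Union>i<N. F i)"
        by (auto simp: a_def k_def xs[symmetric] in_set_conv_nth)
      have ra: "range a \<subseteq> carrier G"
      proof
        fix x assume "x \<in> range a"
        then have "x \<in> insert \<one>\<^bsub>G\<^esub> (a ` {..<k})" by (auto simp: a_def)
        then show "x \<in> carrier G" using F(2) unfolding im by auto
      qed
      have "word_corr G H k a a (v' i) (v' i)" for i
        by (rule elementary_word_corr_refl[OF assms(1,5) ra]) (use F(4) in \<open>auto simp: im v'_def\<close>)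
      then have "cnv_val (conv_algebra G) \<phi> v' = cnv_val (conv_algebra H) \<phi> v'"
        by (rule transfersD[OF saturated_transfers[OF assms(1-4) wf]
              elementary_same_type[OF assms(5) ra] _ v' v'H])
      moreover have "\<bar>cnv_val (conv_algebra G) \<phi> v - cnv_val (conv_algebra G) \<phi> v'\<bar> \<le> \<epsilon>/2"
        using \<delta>(2) v v' dG unfolding cnv_close_def by blast
      moreover have "\<bar>cnv_val (conv_algebra H) \<phi> v - cnv_val (conv_algebra H) \<phi> v'\<bar> \<le> \<epsilon>/2"
        using \<delta>(3) vH v'H dH unfolding cnv_close_def by blast
      ultimately show ?thesis by linarith
    qed
    then have "\<bar>cnv_val (conv_algebra G) \<phi> v - cnv_val (conv_algebra H) \<phi> v\<bar> \<le> 0"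
      by (rule field_le_epsilon[where y = 0, simplified])
    then show ?thesis by simp
  qed
  ultimately show ?thesis unfolding cnv_elementary_substructure_def by blast
qed

end
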